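(* Consider an $s$-stage adapted two-step hybrid (ATSH) method with coefficients $c,b\in\mathbb{R}^{s}$, $A\in\mathbb{R}^{s\times s}$ for the perturbed oscillator $y''=-\omega^2 y+g(y)$, and let $\nu=\omega h$. The ATSH method is of algebraic order $p$ if and only if, for trees $t\in T_2\setminus\{\emptyset\}$, $$b^T\,\psi''(t)=\bigl(1+(-1)^{\rho(t)}\bigr)\,\rho(t)!\,\phi_{\rho(t)}(\nu)$$ holds for all $t$ with $\rho(t)\leq p+1$, but not for some trees of order $\rho(t)=p+2$.
   Context: **Problem.** $y''=f(y)=-\omega^2 y+g(y)$, with $y$ vector-valued, $\omega>0$, $g$ sufficiently smooth; the perturbation is written in autonomous form. **$\phi$-functions.** $\phi_0(\nu)=\cos\nu$, $\phi_1(\nu)=\frac{\sin\nu}{\nu}$, $\phi_{j+2}(\nu)=\int_0^1\frac{\sin(\nu(1-z))}{\nu}\frac{z^j}{j!}\,dz$ for $j\ge 0$. **ATSH method.** With stepsize $h$ and $\nu=\omega h$, $$Y_i=(1+c_i)y_n-c_i y_{n-1}+h^2\sum_{j=1}^s a_{ij}\bigl(-\omega^2Y_j+g(Y_j)\bigr),\quad i=1,\dots,s,$$ $$y_{n+1}=2\phi_0(\nu)y_n-y_{n-1}+h^2\sum_{i=1}^s b_i\,g(Y_i).$$ Here $y_n\approx y(x_n)$, $x_n=x_0+nh$. The coefficients $c=(c_i)$, $A=(a_{ij})$, $b=(b_i)$ may depend on $\nu$. **Algebraic order.** Let $$z(x,h)=\begin{pmatrix} y(x)\\ \frac{y(x+h)-\phi_0(\nu)y(x)}{h}\end{pmatrix},\qquad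 z_n=z(x_n,h),\qquad M(\nu)=\begin{pmatrix}\phi_0(\nu)&0\\-\omega\nu\phi_1^2(\nu)&\phi_0(\nu)\end{pmatrix},$$ $$\Phi(z_{n-1},h)=\begin{pmatrix}\frac{y(x_n)-\phi_0(\nu)y(x_{n-1})}{h}\\ (b^T\otimes I)\,g(Y)\end{pmatrix},$$ where $y(x)$ is the exact solution, $e=(1,\dots,1)^T$, $g(Y)=(g(Y_1),\dots,g(Y_s))^T$, and $Y=(Y_1,\dots,Y_s)^T$ is defined implicitly by $Y=e\otimes y(x_{n-1})+(e+c)\otimes(y(x_n)-y(x_{n-1}))+h^2(A\otimes I)(-\omega^2Y+g(Y))$. The local truncation error of the one-step formulation is $d_n=z_n-M(\nu)z_{n-1}-h\,\Phi(z_{n-1},h)$. The method is of algebraic order $p$ when $d_n=\mathcal{O}(h^{p+1})$ (for all problems of the form $y''=-\omega^2 y+g(y)$ with $y$ vector-valued, $\omega>0$ and $g$ sufficiently smooth), $p$ being the largest such integer. **Trees.** $T_2$ is the set of rooted trees defined recursively as follows: $\emptyset,\tau',\tau\in T_2$; if $t_1,\dots,t_m\in T_2\setminus\{\emptyset\}$ ($m\ge1$, order of the $t_i$ irrelevant), then $t=[t_1,\dots,t_m]_2\in T_2$. The order is $\rho(\emptyset)=0$, $\rho(\tau')=1$, $\rho(\tau)=2$, $\rho([t_1,\dots,t_m]_2)=2+\sum_{i=1}^m\rho(t_i)$. (The associated elementary differentials are $F(\emptyset)(y,y')=y$, $F(\tau')(y,y')=y'$, $F(\tau)(y,y')=f(y)$,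 $F([t_1,\dots,t_m]_2)(y,y')=f^{(m)}(y)(F(t_1)(y,y'),\dots,F(t_m)(y,y'))$.) **Coefficient functions.** For $i=1,\dots,s$ define $\psi_i,\psi_i'':T_2\to\mathbb{R}$ recursively by $$\psi_i(\emptyset)=1,\quad \psi_i(\tau')=c_i,\quad \psi_i(t)=(-1)^{\rho(t)+1}c_i+\sum_{j=1}^s a_{ij}\psi_j''(t)\ \text{ for }\rho(t)\ge2,$$ $$\psi_i''(\emptyset)=\psi_i''(\tau')=0,\quad \psi_i''(\tau)=2,\quad \psi_i''(t)=\rho(t)(\rho(t)-1)\prod_{k=1}^m\psi_i(t_k)\ \text{ for } t=[t_1,\dots,t_m]_2,$$ and $\psi''(t)=(\psi_1''(t),\dots,\psi_s''(t))^T$.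
   Formalization: As ν→0, equality is read up to O(ν^{p+2-ρ(t)}) for ρ(t)≤p+1, and the negated clause says the conditions for ρ(t)≤p+2 up to O(ν^{p+3-ρ(t)}) do not all hold; c, A, b are assumed bounded as ν→0. Exact equality is not necessary: adding a high power of ν to b keeps the order. *)

theory Defs
  imports "HOL-Analysis.Analysis" "HOL-Library.Landau_Symbols" "HOL-Library.Multiset"
begin

section \<open>The phi-functions\<close>

text \<open>Only positive arguments matter below; at \<open>\<nu> = 0\<close> the quotients carry HOL's value
  \<open>x / 0 = 0\<close> and not the analytic continuation.\<close>

fun phi :: "nat \<Rightarrow> real \<Rightarrow> real" where
  "phi 0 \<nu> = cos \<nu>"
| "phi (Suc 0) \<nu> = sin \<nu> / \<nu>"
| "phi (Suc (Suc j)) \<nu> = integral {0..1} (\<lambda>z. sin (\<nu> * (1 - z)) / \<nu> * (z ^ j / fact j))"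


section \<open>Rooted trees and coefficient functions\<close>

text \<open>The datatype also contains terms that are not trees of the theory (\<open>Node {#}\<close>, and nodes
  having the empty tree as a child); \<open>T2\<close> cuts them out.\<close>

datatype tree = EmptyTree | TauPrime | Tau | Node "tree multiset"

inductive_set T2 :: "tree set" where
  "EmptyTree \<in> T2"
| "TauPrime \<in> T2"
| "Tau \<in> T2"
| "ts \<noteq> {#} \<Longrightarrow> (\<And>t. t \<in># ts \<Longrightarrow> t \<in> T2 \<and> t \<noteq> EmptyTree) \<Longrightarrow> Node ts \<in> T2"

primrec rho :: "tree \<Rightarrow> nat" where
  "rho EmptyTree = 0"
| "rho TauPrime = 1"
| "rho Tau = 2"
| "rho (Node ts) = 2 + sum_mset (image_mset rho ts)"

function psi :: "real ^ 's \<Rightarrow> real ^ 's ^ 's \<Rightarrow> tree \<Rightarrow> 's \<Rightarrow> real"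
  and psi'' :: "real ^ 's \<Rightarrow> real ^ 's ^ 's \<Rightarrow> tree \<Rightarrow> 's \<Rightarrow> real" where
  "psi c A EmptyTree i = 1"
| "psi c A TauPrime i = c $ i"
| "psi c A Tau i = (-1) ^ (rho Tau + 1) * c $ i + (\<Sum>j\<in>UNIV. A $ i $ j * psi'' c A Tau j)"
| "psi c A (Node ts) i =
    (-1) ^ (rho (Node ts) + 1) * c $ i + (\<Sum>j\<in>UNIV. A $ i $ j * psi'' c A (Node ts) j)"
| "psi'' c A EmptyTree i = 0"
| "psi'' c A TauPrime i = 0"
| "psi'' c A Tau i = 2"
| "psi'' c A (Node ts) i =
    real (rho (Node ts)) * (real (rho (Node ts)) - 1) * (\<Prod>t\<in>#ts. psi c A t i)"
  by pat_completeness auto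

termination
proof (relation "Wellfounded.measure (\<lambda>x. case x of Inl (c, A, t, i) \<Rightarrow> 2 * size t + 1
                                       | Inr (c, A, t, i) \<Rightarrow> 2 * size t)", goal_cases)
  case (4 c A ts i t)
  then have "size t < size (Node ts)"
    by (induction ts) auto
  then show ?case by simp
qed auto

definition psi''_vec :: "real ^ 's \<Rightarrow> real ^ 's ^ 's \<Rightarrow> tree \<Rightarrow> real ^ 's" where
  "psi''_vec c A t = (\<chi> i. psi'' c A t i)"


section \<open>Initial value problems in arbitrary finite dimension\<close>

text \<open>The algebraic order quantifies over problems of every dimension, so the dimension cannot be
  a type. A vector of \<open>\<real>\<^sup>d\<close> is a function on \<open>nat\<close> vanishing from \<open>d\<close> on; on this set
  the product topology of \<open>nat \<Rightarrow> real\<close> is the Euclidean one.\<close>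

definition Rd :: "nat \<Rightarrow> (nat \<Rightarrow> real) set" where
  "Rd d = {u. \<forall>i\<ge>d. u i = 0}"

text \<open>\<open>Ck d k F\<close>: all partial derivatives of \<open>F : \<real>\<^sup>d \<rightarrow> \<real>\<close> up to order \<open>k\<close> exist and
  are continuous.\<close>

fun Ck :: "nat \<Rightarrow> nat \<Rightarrow> ((nat \<Rightarrow> real) \<Rightarrow> real) \<Rightarrow> bool" where
  "Ck d 0 F \<longleftrightarrow> continuous_on (Rd d) F"
| "Ck d (Suc k) F \<longleftrightarrow> continuous_on (Rd d) F \<and>
    (\<forall>i<d. \<exists>F'. (\<forall>u\<in>Rd d. ((\<lambda>x. F (u(i := x))) has_real_derivative F' u) (at (u i))) \<and> Ck d k F')"

definition perturbation ::
    "nat \<Rightarrow> nat \<Rightarrow> ((nat \<Rightarrow> real) \<Rightarrow> (nat \<Rightarrow> real)) \<Rightarrow> bool" where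
  "perturbation d k g \<longleftrightarrow> (\<forall>u\<in>Rd d. g u \<in> Rd d) \<and> (\<forall>i<d. Ck d k (\<lambda>u. g u i))"

definition solves_oscillator ::
    "nat \<Rightarrow> real \<Rightarrow> ((nat \<Rightarrow> real) \<Rightarrow> (nat \<Rightarrow> real)) \<Rightarrow> (real \<Rightarrow> nat \<Rightarrow> real) \<Rightarrow> real set \<Rightarrow> bool" where
  "solves_oscillator d \<omega> g y I \<longleftrightarrow> (\<forall>x\<in>I. y x \<in> Rd d) \<and>
    (\<exists>y'. \<forall>x\<in>I. \<forall>i<d. ((\<lambda>x. y x i) has_real_derivative y' x i) (at x) \<and>
      ((\<lambda>x. y' x i) has_real_derivative (- \<omega>\<^sup>2 * y x i + g (y x) i)) (at x))"


section \<open>Local truncation error and algebraic order\<close>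

text \<open>In the following \<open>xn\<close> is the grid point \<open>x\<^sub>n\<close>, so \<open>x\<^sub>n\<^sub>-\<^sub>1\<close> is \<open>xn - h\<close>. The
  coefficients are those at the given \<open>\<nu> = \<omega> h\<close>, and \<open>Y j\<close> is the stage vector \<open>Y\<^sub>j\<close>.\<close>

definition stage_equations ::
    "real ^ 's \<Rightarrow> real ^ 's ^ 's \<Rightarrow> nat \<Rightarrow> real \<Rightarrow> ((nat \<Rightarrow> real) \<Rightarrow> (nat \<Rightarrow> real)) \<Rightarrow>
      (real \<Rightarrow> nat \<Rightarrow> real) \<Rightarrow> real \<Rightarrow> real \<Rightarrow> ('s \<Rightarrow> nat \<Rightarrow> real) \<Rightarrow> bool" where
  "stage_equations c A d \<omega> g y xn h Y \<longleftrightarrow> (\<forall>j. Y j \<in> Rd d \<and> (\<forall>i<d.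
     Y j i = y (xn - h) i + (1 + c $ j) * (y xn i - y (xn - h) i)
       + h\<^sup>2 * (\<Sum>k\<in>UNIV. A $ j $ k * (- \<omega>\<^sup>2 * Y k i + g (Y k) i))))"

text \<open>The block vectors \<open>z\<close>, \<open>\<Phi>\<close> and \<open>d\<^sub>n\<close> have two blocks of length \<open>d\<close>; they are
  given through their \<open>i\<close>-th components \<open>(first block, second block) \<in> \<real>\<^sup>2\<close>, on each of
  which \<open>M(\<nu>)\<close> acts.\<close>

definition zvec :: "(real \<Rightarrow> nat \<Rightarrow> real) \<Rightarrow> real \<Rightarrow> real \<Rightarrow> real \<Rightarrow> nat \<Rightarrow> real ^ 2" where
  "zvec y \<omega> x h i = vector [y x i, (y (x + h) i - phi 0 (\<omega> * h) * y x i) / h]"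

definition Mmat :: "real \<Rightarrow> real \<Rightarrow> real ^ 2 ^ 2" where
  "Mmat \<omega> \<nu> = vector [vector [phi 0 \<nu>, 0], vector [- \<omega> * \<nu> * (phi 1 \<nu>)\<^sup>2, phi 0 \<nu>]]"

definition Phi_incr ::
    "real ^ 's \<Rightarrow> real \<Rightarrow> ((nat \<Rightarrow> real) \<Rightarrow> (nat \<Rightarrow> real)) \<Rightarrow> (real \<Rightarrow> nat \<Rightarrow> real) \<Rightarrow>
      real \<Rightarrow> real \<Rightarrow> ('s \<Rightarrow> nat \<Rightarrow> real) \<Rightarrow> nat \<Rightarrow> real ^ 2" where
  "Phi_incr b \<omega> g y xn h Y i =
     vector [(y xn i - phi 0 (\<omega> * h) * y (xn - h) i) / h, \<Sum>j\<in>UNIV. b $ j * g (Y j) i]"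

definition local_error ::
    "real ^ 's \<Rightarrow> real \<Rightarrow> ((nat \<Rightarrow> real) \<Rightarrow> (nat \<Rightarrow> real)) \<Rightarrow> (real \<Rightarrow> nat \<Rightarrow> real) \<Rightarrow>
      real \<Rightarrow> real \<Rightarrow> ('s \<Rightarrow> nat \<Rightarrow> real) \<Rightarrow> nat \<Rightarrow> real ^ 2" where
  "local_error b \<omega> g y xn h Y i =
     zvec y \<omega> xn h i - Mmat \<omega> (\<omega> * h) *v zvec y \<omega> (xn - h) h i - h *\<^sub>R Phi_incr b \<omega> g y xn h Y i"

text \<open>\<open>local_error_order c A b q\<close> says \<open>d\<^sub>n = O(h\<^sup>q)\<close> as \<open>h \<rightarrow> 0\<close>, for each fixed problem (in
  particular fixed \<open>\<omega>\<close>, so \<open>\<nu> = \<omega> h \<rightarrow> 0\<close>), each \<open>x\<^sub>0\<close> in the interval of existence and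
  each \<open>n\<close>. ``Sufficiently smooth'' is the existential quantifier over the class \<open>C\<^sup>k\<close>.
  For nonlinear \<open>g\<close> the stage equations may have further solutions far away from the
  trajectory; \<open>Y\<close> is the branch that tends to \<open>y(x\<^sub>0)\<close>.\<close>

definition local_error_order ::
    "(real \<Rightarrow> real ^ 's) \<Rightarrow> (real \<Rightarrow> real ^ 's ^ 's) \<Rightarrow> (real \<Rightarrow> real ^ 's) \<Rightarrow> nat \<Rightarrow> bool" where
  "local_error_order c A b q \<longleftrightarrow> (\<exists>k. \<forall>d \<omega> g y \<alpha> \<beta> x0 (n::nat) Y.
     \<omega> > 0 \<and> perturbation d k g \<and> solves_oscillator d \<omega> g y {\<alpha><..<\<beta>} \<and> x0 \<in> {\<alpha><..<\<beta>} \<and>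
     (\<forall>\<^sub>F h in at_right 0. stage_equations (c (\<omega> * h)) (A (\<omega> * h)) d \<omega> g y (x0 + n * h) h (Y h)) \<and>
     (\<forall>j. \<forall>i<d. ((\<lambda>h. Y h j i) \<longlongrightarrow> y x0 i) (at_right 0)) \<longrightarrow>
     (\<forall>i<d. (\<lambda>h. norm (local_error (b (\<omega> * h)) \<omega> g y (x0 + n * h) h (Y h) i))
               \<in> O[at_right 0](\<lambda>h. h ^ q)))"

definition algebraic_order ::
    "(real \<Rightarrow> real ^ 's) \<Rightarrow> (real \<Rightarrow> real ^ 's ^ 's) \<Rightarrow> (real \<Rightarrow> real ^ 's) \<Rightarrow> nat \<Rightarrow> bool" where
  "algebraic_order c A b p \<longleftrightarrow>
     local_error_order c A b (p + 1) \<and> (\<forall>q. local_error_order c A b (q + 1) \<longrightarrow> q \<le> p)"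

text \<open>\<open>order_condition c A b q t\<close>: the equation
  \<open>b\<^sup>T \<psi>''(t) = (1 + (-1)\<^sup>\<rho>) \<rho>! \<phi>\<^sub>\<rho>(\<nu>)\<close>, \<open>\<rho> = \<rho>(t) \<le> q\<close>, between functions of
  \<open>\<nu>\<close>. As \<open>\<nu> = \<omega> h\<close> and \<open>t\<close> enters the local error with the factor \<open>h\<^sup>\<rho>\<close>, equality
  is understood modulo \<open>h\<^sup>\<rho> O(\<nu>\<^sup>q\<^sup>+\<^sup>1\<^sup>-\<^sup>\<rho>) = O(h\<^sup>q\<^sup>+\<^sup>1)\<close>, i.e. up to the terms coming from
  trees of order \<open>> q\<close>. Exact equality is not necessary: changing \<open>b\<close> by a high power of \<open>\<nu>\<close>
  does not change the order of the method.\<close>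

definition order_condition ::
    "(real \<Rightarrow> real ^ 's) \<Rightarrow> (real \<Rightarrow> real ^ 's ^ 's) \<Rightarrow> (real \<Rightarrow> real ^ 's) \<Rightarrow> nat \<Rightarrow> tree \<Rightarrow> bool" where
  "order_condition c A b q t \<longleftrightarrow>
     (\<lambda>\<nu>. b \<nu> \<bullet> psi''_vec (c \<nu>) (A \<nu>) t - (1 + (-1) ^ rho t) * fact (rho t) * phi (rho t) \<nu>)
       \<in> O[at_right 0](\<lambda>\<nu>. \<nu> ^ (q + 1 - rho t))"

end

(* The variation-of-constants formula gives d_n = h (L(g o y) - sum_j b_j g(Y_j)) with a linear
   functional L whose values on monomials are phi-functions. Sufficiency: the exact solution near x_n
   and the stage values are expanded simultaneously over forests of trees, with the same coefficients.
   This relation survives products (hence composition with Taylor polynomials of g) and passes from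
   y'' to y with a gain of two orders, so it can be bootstrapped; the order condition of t is then the
   vanishing of the defect on the forest of children of t.
   Necessity: for omega = 1 and g(u) = u + f(u) with f triangular and polynomial, one component per
   subtree of t, the solution is x^rho(t) and the stage values are exactly h^rho(t) psi_j(t). Since
   the root carries g and not f, this yields a condition on b^T (psi'' + nu^2 psi)(t), from which
   psi is removed by descending induction on the order, using the condition of [t]_2 and the
   recurrence phi_m = 1/m! - nu^2 phi_(m+2). *)
theory Submission
  imports Defs
begin

section \<open>The phi-functions\<close>

text \<open>No elementary differentials occur, and with them no symmetry coefficients: a forest
  carries an arbitrary bounded factor \<open>\<kappa> h\<close>, and all that matters is that the
  solution and the stages share it. The defect is linear in this pair, so it can be tested on one
  forest at a time. A forest of total order m contributes h^m, its root raises the order to m + 2,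
  and the condition of that tree holds modulo h^(q-1-m); together with the factor h in front of the
  defect this gives h^q. The bootstrap has to start from stages that are only known to converge to
  y(x0). The stage equations first turn this into a rate O(h); this rate keeps all arguments of g in
  a box of radius K h, where g can be traded for a polynomial. In the test problem the summand u of
  g cancels the oscillator term, so that y'' = f(y) and the stage equations are those of a purely
  polynomial triangular system. A polynomial g belongs to every class \<open>Ck\<close>, hence the
  unknown smoothness k inside \<open>local_error_order\<close> does no harm.\<close>

lemma sin_quotient_bound:
  fixes \<nu> z :: real
  assumes "\<nu> > 0" "z \<in> {0..1}"
  shows "\<bar>sin (\<nu> * (1 - z)) / \<nu>\<bar> \<le> 1"
proof -
  have "\<bar>sin (\<nu> * (1 - z))\<bar> \<le> \<bar>\<nu> * (1 - z)\<bar>"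
    by (rule abs_sin_x_le_abs_x)
  also have "\<dots> \<le> \<nu>"
    using assms by (simp add: abs_mult mult_left_le)
  finally show ?thesis
    using assms by simp
qed

lemma phi_bound:
  assumes "\<nu> > 0"
  shows "\<bar>phi (Suc (Suc j)) \<nu>\<bar> \<le> 1"
proof -
  have "norm (integral {0..1} (\<lambda>z. sin (\<nu> * (1 - z)) / \<nu> * (z ^ j / fact j))) \<le> 1 * (1 - 0)"
  proof (rule integral_bound)
    show "continuous_on {0..1} (\<lambda>z. sin (\<nu> * (1 - z)) / \<nu> * (z ^ j / fact j))"
      using assms by (intro continuous_intros) auto
    fix z :: real assume z: "z \<in> {0..1}"
    have "\<bar>z ^ j / fact j\<bar> \<le> 1"
    proof -
      have "z ^ j \<le> 1" using z by (auto intro: power_le_one)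
      also have "(1::real) \<le> fact j" by (rule fact_ge_1)
      finally show ?thesis using z by simp
    qed
    then show "norm (sin (\<nu> * (1 - z)) / \<nu> * (z ^ j / fact j)) \<le> 1"
      unfolding real_norm_def abs_mult
      using sin_quotient_bound[OF assms z] by (intro mult_le_one) auto
  qed auto
  then show ?thesis by simp
qed

lemma phi_Suc_Suc_bigo: "phi (Suc (Suc j)) \<in> O[at_right 0](\<lambda>_. 1)"
  using phi_bound by (intro bigoI[where c = 1] eventually_at_right_less[THEN eventually_mono]) simp

text \<open>Two integrations by parts: \<open>S' = - K\<close> and
  \<open>K' = \<nu>\<^sup>2 * S\<close>. The cases m = 0 and m = 1 stand apart because
  \<open>phi\<close> is a closed expression there and not an integral.\<close>

lemma phi_recurrence:
  assumes "\<nu> > 0"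
  shows "phi m \<nu> = 1 / fact m - \<nu>\<^sup>2 * phi (Suc (Suc m)) \<nu>"
proof -
  define S K where "S = (\<lambda>z. sin (\<nu> * (1 - z)) / \<nu>)" and "K = (\<lambda>z. cos (\<nu> * (1 - z)))"
  have S: "(S has_real_derivative - K z) (at z within X)" for z X
    unfolding S_def K_def using assms by (auto intro!: derivative_eq_intros)
  have K: "(K has_real_derivative \<nu>\<^sup>2 * S z) (at z within X)" for z X
    unfolding S_def K_def using assms
    by (auto intro!: derivative_eq_intros simp: power2_eq_square)
  have int: "(\<lambda>z. S z * (z ^ j / fact j)) integrable_on {0..1}" for j
    unfolding S_def using assms by (intro integrable_continuous_real continuous_intros) auto
  have phi: "phi (Suc (Suc j)) \<nu> = integral {0..1} (\<lambda>z. S z * (z ^ j / fact j))" for j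
    by (simp add: S_def)
  have ftc: "integral {0..1} w = W 1 - W 0"
    if "\<And>z. (W has_real_derivative w z) (at z within {0..1})" for W w :: "real \<Rightarrow> real"
    using that by (intro integral_unique fundamental_theorem_of_calculus)
      (auto simp: has_real_derivative_iff_has_vector_derivative[symmetric])
  consider "m = 0" | "m = 1" | n where "m = Suc (Suc n)"
    by (metis One_nat_def not0_implies_Suc)
  then show ?thesis
  proof cases
    case 1
    have "integral {0..1} (\<lambda>z. \<nu>\<^sup>2 * (S z * (z ^ 0 / fact 0))) = K 1 - K 0"
      using K by (intro ftc) simp
    then show ?thesis
      unfolding integral_mult_right using 1 phi[of 0] by (simp add: K_def)
  next
    case 2
    have "integral {0..1} (\<lambda>z. \<nu>\<^sup>2 * (S z * (z ^ 1 / fact 1))) = (K 1 * 1 + S 1) - (K 0 * 0 + S 0)"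
      by (intro ftc[where W = "\<lambda>z. K z * z + S z"])
        (auto intro!: derivative_eq_intros K S)
    then show ?thesis
      unfolding integral_mult_right using 2 phi[of 1] by (simp add: K_def S_def)
  next
    case 3
    \<comment> \<open>The boundary terms of both integrations by parts; when \<open>W\<close> is
      differentiated, the two terms containing \<open>K\<close> cancel.\<close>
    define W where "W z = K z * (z ^ Suc (Suc n) / fact (Suc (Suc n))) + S z * (z ^ Suc n / fact (Suc n))" for z
    have pow: "((\<lambda>z. z ^ Suc k / fact (Suc k)) has_real_derivative z ^ k / fact k) (at z within X)"
      for k and z :: real and X
    proof -
      have "((\<lambda>z. z ^ Suc k / fact (Suc k)) has_real_derivative (of_nat (Suc k) * z ^ k) / fact (Suc k)) (at z within X)"
        by (rule DERIV_cdivide) (rule derivative_eq_intros refl | simp)+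
      moreover have "(of_nat (Suc k) * z ^ k) / fact (Suc k) = z ^ k / fact k"
        by (simp del: of_nat_Suc)
      ultimately show ?thesis by simp
    qed
    have "integral {0..1} (\<lambda>z. \<nu>\<^sup>2 * (S z * (z ^ m / fact m)) + S z * (z ^ n / fact n)) = W 1 - W 0"
    proof (rule ftc)
      fix z :: real
      show "(W has_real_derivative \<nu>\<^sup>2 * (S z * (z ^ m / fact m)) + S z * (z ^ n / fact n)) (at z within {0..1})"
        unfolding W_def
        by (rule DERIV_cong[OF DERIV_add[OF DERIV_mult[OF K pow] DERIV_mult[OF S pow]]])
          (simp add: 3 mult_ac del: fact_Suc power_Suc)
    qed
    moreover have "W 1 - W 0 = 1 / fact m"
      by (simp add: W_def K_def S_def 3)
    moreover have "integral {0..1} (\<lambda>z. \<nu>\<^sup>2 * (S z * (z ^ m / fact m)) + S z * (z ^ n / fact n))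
        = \<nu>\<^sup>2 * phi (Suc (Suc m)) \<nu> + phi m \<nu>"
      unfolding 3 phi
      by (subst integral_add[OF integrable_on_mult_right[OF int] int]) (simp del: fact_Suc power_Suc)
    ultimately show ?thesis by simp
  qed
qed


section \<open>Trees and the local error\<close>

lemma rho_pos: "t \<noteq> EmptyTree \<Longrightarrow> 1 \<le> rho t"
  by (cases t) auto

text \<open>The recursion for \<open>psi''\<close> with the values at the children left open. The
  same expression serves twice: at \<open>psi\<close> it is \<open>psi''\<close>, and at the
  components of a vector it is the right-hand side f of the test problem.\<close>

definition tree_field :: "tree \<Rightarrow> (tree \<Rightarrow> real) \<Rightarrow> real" where
  "tree_field t v = (case t of EmptyTree \<Rightarrow> 0 | TauPrime \<Rightarrow> 0 | Tau \<Rightarrow> 2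
     | Node ts \<Rightarrow> real (rho t) * (real (rho t) - 1) * (\<Prod>s\<in>#ts. v s))"

lemma psi''_tree_field: "psi'' c A t j = tree_field t (\<lambda>s. psi c A s j)"
  by (cases t) (simp_all add: tree_field_def)

lemma psi_nonempty:
  "t \<noteq> EmptyTree \<Longrightarrow> psi c A t j = (-1) ^ (rho t + 1) * c $ j + (\<Sum>k\<in>UNIV. A $ j $ k * psi'' c A t k)"
  by (cases t) simp_all

lemma prod_mset_power: "(\<Prod>s\<in>#ts. x ^ f s) = (x :: 'a :: comm_monoid_mult) ^ (\<Sum>s\<in>#ts. f s)"
  by (induction ts) (simp_all add: power_add)

text \<open>The orders of the children add up to \<open>rho t - 2\<close>, and
  \<open>h\<^sup>2\<close> makes up for the root. This homogeneity makes
  \<open>h ^ rho t * psi\<close> an exact solution of the stage equations of the test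
  problem.\<close>

lemma tree_field_scale:
  "h\<^sup>2 * tree_field t (\<lambda>s. h ^ rho s * v s) = h ^ rho t * tree_field t v"
  by (cases t) (simp_all add: tree_field_def prod_mset.distrib prod_mset_power power_add power2_eq_square)

text \<open>The right-hand side is the second derivative of \<open>x ^ rho t\<close>; this is why
  monomials solve the test problem.\<close>

lemma tree_field_monomial:
  "tree_field t (\<lambda>s. x ^ rho s) = real (rho t) * (real (rho t) - 1) * x ^ (rho t - 2)"
  by (cases t) (simp_all add: tree_field_def prod_mset_power)

text \<open>Provides the index set of the test problem: finiteness gives a dimension, and closure
  under children keeps the vector field within these components.\<close>

lemma T2_subtree_closed:
  assumes "t \<in> T2" "t \<noteq> EmptyTree"
  obtains S where "finite S" "t \<in> S" "S \<subseteq> T2 - {EmptyTree}"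
    "\<And>ts s. Node ts \<in> S \<Longrightarrow> s \<in># ts \<Longrightarrow> s \<in> S"
proof -
  have "t \<noteq> EmptyTree \<longrightarrow> (\<exists>S. finite S \<and> t \<in> S \<and> S \<subseteq> T2 - {EmptyTree} \<and>
      (\<forall>ts s. Node ts \<in> S \<longrightarrow> s \<in># ts \<longrightarrow> s \<in> S))"
    using assms(1)
  proof induction
    case 2
    show ?case by (intro impI exI[of _ "{TauPrime}"]) (auto intro: T2.intros)
  next
    case 3
    show ?case by (intro impI exI[of _ "{Tau}"]) (auto intro: T2.intros)
  next
    case (4 ts)
    then obtain S where S: "\<And>t. t \<in># ts \<Longrightarrow> finite (S t) \<and> t \<in> S t \<and> S t \<subseteq> T2 - {EmptyTree} \<and>
      (\<forall>us s. Node us \<in> S t \<longrightarrow> s \<in># us \<longrightarrow> s \<in> S t)"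
      by metis
    have "Node ts \<in> T2" using 4 by (intro T2.intros) auto
    have closed: "s \<in> insert (Node ts) (\<Union>t\<in>set_mset ts. S t)"
      if "Node us \<in> insert (Node ts) (\<Union>t\<in>set_mset ts. S t)" "s \<in># us" for us s
      using that(1)
    proof
      assume "Node us = Node ts"
      with that S show ?thesis by blast
    next
      assume "Node us \<in> (\<Union>t\<in>set_mset ts. S t)"
      with that S show ?thesis by blast
    qed
    have "insert (Node ts) (\<Union>t\<in>set_mset ts. S t) \<subseteq> T2 - {EmptyTree}"
      using S \<open>Node ts \<in> T2\<close> by blast
    moreover have "finite (insert (Node ts) (\<Union>t\<in>set_mset ts. S t))"
      using S by simp
    ultimately show ?case using closed by blast
  qed simp
  with assms that show thesis by blast
qed

section \<open>Bounded coefficients in Landau notation\<close>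

lemma Bfun_vec_nth_bigo:
  fixes c :: "'a \<Rightarrow> real ^ 's"
  assumes "Bfun c F"
  shows "(\<lambda>h. c h $ j) \<in> O[F](\<lambda>_. 1)"
proof -
  obtain K where "\<forall>\<^sub>F h in F. norm (c h) \<le> K"
    using assms by (rule BfunE)
  then have "\<forall>\<^sub>F h in F. norm (c h $ j) \<le> K * norm (1::real)"
    by (rule eventually_mono) (simp add: order_trans[OF component_le_norm_cart])
  then show ?thesis by (rule bigoI)
qed

lemma Bfun_matrix_nth_bigo:
  fixes A :: "'a \<Rightarrow> real ^ 's ^ 'r"
  assumes "Bfun A F"
  shows "(\<lambda>h. A h $ i $ j) \<in> O[F](\<lambda>_. 1)"
proof (rule Bfun_vec_nth_bigo)
  obtain K where K: "\<forall>\<^sub>F h in F. norm (A h) \<le> K"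
    using assms by (rule BfunE)
  show "Bfun (\<lambda>h. A h $ i) F"
    by (rule BfunI[where K = K], rule eventually_mono[OF K]) (rule order_trans[OF Finite_Cartesian_Product.norm_nth_le])
qed

lemma prod_mset_bigo_1:
  fixes f :: "'b \<Rightarrow> 'a \<Rightarrow> real"
  shows "(\<And>s. s \<in># ts \<Longrightarrow> f s \<in> O[F](\<lambda>_. 1)) \<Longrightarrow> (\<lambda>h. \<Prod>s\<in>#ts. f s h) \<in> O[F](\<lambda>_. 1)"
  by (induction ts) (auto intro!: landau_o.big.mult_in_1)

lemma tendsto_zero_bigo:
  fixes f g :: "'a \<Rightarrow> real"
  assumes "f \<in> O[F](g)" "(g \<longlongrightarrow> 0) F"
  shows "(f \<longlongrightarrow> 0) F"
proof -
  have "g \<in> o[F](\<lambda>_. 1)"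
    using assms(2) by (intro smalloI_tendsto) simp_all
  with assms(1) have "f \<in> o[F](\<lambda>_. 1)"
    by (rule landau_o.big_small_trans)
  then show ?thesis
    by (auto dest: smalloD_tendsto)
qed

lemma psi_bigo_1:
  fixes c :: "real \<Rightarrow> real ^ 's"
  assumes "Bfun c F" "Bfun A F"
  shows "(\<lambda>h. psi (c h) (A h) t j) \<in> O[F](\<lambda>_. 1)"
proof (induction t arbitrary: j)
  case (Node ts)
  have "(\<lambda>h. psi'' (c h) (A h) (Node ts) k) \<in> O[F](\<lambda>_. 1)" for k
    unfolding psi''.simps
    by (intro landau_o.big.mult_in_1 prod_mset_bigo_1 Node.IH bigo_const)
  then show ?case
    unfolding psi.simps
    by (intro sum_in_bigo landau_o.big.mult_in_1 big_sum_in_bigo bigo_const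
        Bfun_vec_nth_bigo Bfun_matrix_nth_bigo assms)
next
  case Tau
  show ?case
    unfolding psi.simps psi''.simps
    by (intro sum_in_bigo landau_o.big.mult_in_1 big_sum_in_bigo bigo_const
        Bfun_vec_nth_bigo Bfun_matrix_nth_bigo assms)
qed (use Bfun_vec_nth_bigo[OF assms(1)] in simp_all)

text \<open>The first block of d_n vanishes identically by the choice of the first block of \<Phi>.
  In the second, the off-diagonal entry of M is tuned so that the terms in y(x_n - h) combine to
  cos^2 + sin^2 = 1, which leaves the residual of the two-step recursion divided by h.\<close>

lemma norm_local_error:
  assumes "\<omega> > 0" "h > 0"
  shows "norm (local_error b \<omega> g y xn h Y i) =
    \<bar>(y (xn + h) i - 2 * cos (\<omega> * h) * y xn i + y (xn - h) i) / h - h * (\<Sum>j\<in>UNIV. b $ j * g (Y j) i)\<bar>"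
proof -
  have M: "\<omega> * (\<omega> * h) * (phi 1 (\<omega> * h))\<^sup>2 = (1 - (cos (\<omega> * h))\<^sup>2) / h"
    unfolding sin_squared_eq[symmetric] using assms by (simp add: power2_eq_square)
  have comp1: "local_error b \<omega> g y xn h Y i $ 1 = 0"
    using assms(2)
    by (simp add: local_error_def zvec_def Mmat_def Phi_incr_def matrix_vector_mult_def sum_2)
  have "local_error b \<omega> g y xn h Y i $ 2 = (y (xn + h) i - cos (\<omega> * h) * y xn i) / h
      - (- (\<omega> * (\<omega> * h) * (phi 1 (\<omega> * h))\<^sup>2) * y (xn - h) i
        + cos (\<omega> * h) * ((y xn i - cos (\<omega> * h) * y (xn - h) i) / h))
      - h * (\<Sum>j\<in>UNIV. b $ j * g (Y j) i)"
    by (simp add: local_error_def zvec_def Mmat_def Phi_incr_def matrix_vector_mult_def sum_2)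
  also have "\<dots> =
    (y (xn + h) i - 2 * cos (\<omega> * h) * y xn i + y (xn - h) i) / h - h * (\<Sum>j\<in>UNIV. b $ j * g (Y j) i)"
    unfolding M by (simp add: diff_divide_distrib add_divide_distrib power2_eq_square algebra_simps)
  finally show ?thesis
    using comp1 by (simp add: norm_vec_def L2_set_def sum_2)
qed


section \<open>Necessity of the order conditions\<close>

lemma Ck_const: "Ck d k (\<lambda>u. c)"
proof (induction k arbitrary: c)
  case (Suc k)
  then show ?case by (auto intro!: exI[of _ "\<lambda>_. 0"])
qed simp

lemma Ck_coordinate: "Ck d k (\<lambda>u. u j)"
proof (cases k)
  case (Suc m)
  have "((\<lambda>x. (u(i := x)) j) has_real_derivative (if i = j then 1 else 0)) (at (u i))"
    for u :: "nat \<Rightarrow> real" and i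
    by (cases "i = j") simp_all
  then show ?thesis
    using Suc by (auto intro!: exI[of _ "\<lambda>_. if i = j then 1 else 0" for i] Ck_const
        continuous_on_subset[OF continuous_on_product_coordinates])
qed (auto intro!: continuous_on_subset[OF continuous_on_product_coordinates])

lemma Ck_SucD: "Ck d (Suc k) F \<Longrightarrow> Ck d k F"
proof (induction k arbitrary: F)
  case (Suc k)
  then show ?case by (subst Ck.simps) (subst (asm) Ck.simps, blast)
qed simp

lemma Ck_antimono: "Ck d l F \<Longrightarrow> k \<le> l \<Longrightarrow> Ck d k F"
  by (induction l) (auto simp: le_Suc_eq dest: Ck_SucD simp del: Ck.simps(2))

lemma Ck_continuous_on: "Ck d k F \<Longrightarrow> continuous_on (Rd d) F"
  by (cases k) auto

lemma Ck_add:
  "Ck d k F \<Longrightarrow> Ck d k G \<Longrightarrow> Ck d k (\<lambda>u. F u + G u)"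
proof (induction k arbitrary: F G)
  case (Suc k)
  have "\<exists>F'. (\<forall>u\<in>Rd d. ((\<lambda>x. F (u(i := x)) + G (u(i := x))) has_real_derivative F' u) (at (u i))) \<and> Ck d k F'"
    if i: "i < d" for i
  proof -
    obtain F' where F': "\<forall>u\<in>Rd d. ((\<lambda>x. F (u(i := x))) has_real_derivative F' u) (at (u i))" "Ck d k F'"
      using Suc.prems(1) i by auto
    obtain G' where G': "\<forall>u\<in>Rd d. ((\<lambda>x. G (u(i := x))) has_real_derivative G' u) (at (u i))" "Ck d k G'"
      using Suc.prems(2) i by auto
    show ?thesis
      by (rule exI[of _ "\<lambda>u. F' u + G' u"]) (use F' G' Suc.IH in \<open>auto intro!: DERIV_add\<close>)
  qed
  with Suc.prems show ?case by (auto intro: continuous_on_add)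
qed (auto intro: continuous_on_add)

lemma Ck_mult:
  "Ck d k F \<Longrightarrow> Ck d k G \<Longrightarrow> Ck d k (\<lambda>u. F u * G u)"
proof (induction k arbitrary: F G)
  case (Suc k)
  have "\<exists>F'. (\<forall>u\<in>Rd d. ((\<lambda>x. F (u(i := x)) * G (u(i := x))) has_real_derivative F' u) (at (u i))) \<and> Ck d k F'"
    if i: "i < d" for i
  proof -
    obtain F' where F': "\<forall>u\<in>Rd d. ((\<lambda>x. F (u(i := x))) has_real_derivative F' u) (at (u i))" "Ck d k F'"
      using Suc.prems(1) i by auto
    obtain G' where G': "\<forall>u\<in>Rd d. ((\<lambda>x. G (u(i := x))) has_real_derivative G' u) (at (u i))" "Ck d k G'"
      using Suc.prems(2) i by auto
    have deriv: "((\<lambda>x. F (u(i := x)) * G (u(i := x))) has_real_derivative F' u * G u + G' u * F u) (at (u i))"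
      if "u \<in> Rd d" for u
      using DERIV_mult[OF F'(1)[rule_format, OF that] G'(1)[rule_format, OF that]] by simp
    have "Ck d k (\<lambda>u. F' u * G u + G' u * F u)"
      by (rule Ck_add[OF Suc.IH[OF F'(2) Ck_SucD[OF Suc.prems(2)]] Suc.IH[OF G'(2) Ck_SucD[OF Suc.prems(1)]]])
    with deriv show ?thesis
      by (intro exI[of _ "\<lambda>u. F' u * G u + G' u * F u"] conjI ballI)
  qed
  with Suc.prems show ?case by (auto intro: continuous_on_mult)
qed (auto intro: continuous_on_mult)

lemma Ck_prod_mset: "(\<And>s. s \<in># ts \<Longrightarrow> Ck d k (F s)) \<Longrightarrow> Ck d k (\<lambda>u. \<Prod>s\<in>#ts. F s u)"
proof (induction ts)
  case empty
  show ?case using Ck_const[of d k 1] by simp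
next
  case (add s ts)
  then have "Ck d k (\<lambda>u. F s u * (\<Prod>s\<in>#ts. F s u))" by (intro Ck_mult) auto
  then show ?case by simp
qed

lemma Ck_tree_field: "Ck d k (\<lambda>u. tree_field t (\<lambda>s. u (f s)))"
  by (cases t) (auto simp: tree_field_def intro!: Ck_const Ck_mult Ck_prod_mset Ck_coordinate)

text \<open>The test problem has one component \<open>y\<^sub>t(x) = x\<^bsup>\<rho>(t)\<^esup>\<close> for each subtree of \<open>t\<close>; the choice
  \<open>g(u) = u + f(u)\<close> with \<open>f\<close> strictly triangular makes the stage values exactly \<open>h\<^bsup>\<rho>(t)\<^esup> \<psi>\<^sub>j(t)\<close>.\<close>

lemma local_error_order_test_problem:
  fixes c b :: "real \<Rightarrow> real ^ 's" and A :: "real \<Rightarrow> real ^ 's ^ 's"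
  assumes bounded: "Bfun c (at_right 0)" "Bfun A (at_right 0)"
    and order: "local_error_order c A b q"
    and t: "t \<in> T2" "t \<noteq> EmptyTree" and le: "rho t \<le> q"
  shows "(\<lambda>h. (\<Sum>j\<in>UNIV. b h $ j * (psi'' (c h) (A h) t j + h\<^sup>2 * psi (c h) (A h) t j)) - (1 + (-1) ^ rho t))
    \<in> O[at_right 0](\<lambda>h. h ^ (q + 1 - rho t))"
proof -
  obtain S where S: "finite S" "t \<in> S" "S \<subseteq> T2 - {EmptyTree}"
    "\<And>ts s. Node ts \<in> S \<Longrightarrow> s \<in># ts \<Longrightarrow> s \<in> S"
    by (rule T2_subtree_closed[OF t]) blast
  define d where "d = card S"
  obtain tr where tr: "bij_betw tr {0..<d} S"
    using ex_bij_betw_nat_finite[OF S(1)] d_def by blast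
  define idx where "idx = inv_into {0..<d} tr"
  have tr_S: "tr i \<in> S" if "i < d" for i
    using tr that by (auto simp: bij_betw_def)
  have idx: "idx s < d" "tr (idx s) = s" if "s \<in> S" for s
    using that bij_betw_inv_into_right[OF tr that] bij_betwE[OF bij_betw_inv_into[OF tr]]
    by (auto simp: idx_def)
  have nonempty: "tr i \<noteq> EmptyTree" if "i < d" for i
    using tr_S[OF that] S(3) by blast
  have rho: "1 \<le> rho (tr i)" if "i < d" for i
    using rho_pos[OF nonempty[OF that]] .
  define lift where "lift v = (\<lambda>i. if i < d then v (tr i) else 0 :: real)" for v :: "tree \<Rightarrow> real"
  \<comment> \<open>For \<omega> = 1 the summand \<open>u i\<close> cancels the oscillator term, so
    the differential equation and the stage equations see \<open>tree_field\<close> alone; only the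
    final sum with the weights \<open>b\<close> sees all of \<open>g\<close>.\<close>
  define g where "g u = (\<lambda>i. if i < d then u i + tree_field (tr i) (\<lambda>s. u (idx s)) else 0)" for u :: "nat \<Rightarrow> real"
  define y where "y x = lift (\<lambda>s. x ^ rho s)" for x :: real
  define Y where "Y h j = lift (\<lambda>s. h ^ rho s * psi (c h) (A h) s j)" for h j
  have field_lift: "tree_field (tr i) (\<lambda>s. lift v (idx s)) = tree_field (tr i) v" if "i < d" for v i
  proof (cases "tr i")
    case (Node ts)
    have "s \<in> S" if "s \<in># ts" for s
      using S(4) tr_S[OF \<open>i < d\<close>] Node that by auto
    then have "image_mset (\<lambda>s. lift v (idx s)) ts = image_mset v ts"
      by (intro image_mset_cong) (simp add: lift_def idx)
    then show ?thesis by (simp add: tree_field_def Node)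
  qed (simp_all add: tree_field_def)
  have Rd: "lift v \<in> Rd d" for v
    by (simp add: lift_def Rd_def)
  have pert: "perturbation d k g" for k
    using Ck_add[OF Ck_coordinate Ck_tree_field] by (simp add: perturbation_def g_def Rd_def)
  have sol: "solves_oscillator d 1 g y {-1<..<1}"
    unfolding solves_oscillator_def
  proof (intro conjI ballI exI allI impI)
    show "y x \<in> Rd d" for x
      by (simp add: y_def Rd)
    fix x :: real and i assume i: "i < d"
    show "((\<lambda>x. y x i) has_real_derivative real (rho (tr i)) * x ^ (rho (tr i) - 1)) (at x)"
      using i by (auto simp: y_def lift_def intro!: derivative_eq_intros)
    have "- 1\<^sup>2 * y x i + g (y x) i = tree_field (tr i) (\<lambda>s. x ^ rho s)"
      using i by (simp add: g_def y_def field_lift)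
    also have "\<dots> = real (rho (tr i)) * ((real (rho (tr i)) - 1) * x ^ (rho (tr i) - 2))"
      by (simp add: tree_field_monomial)
    finally show "((\<lambda>x. real (rho (tr i)) * x ^ (rho (tr i) - 1)) has_real_derivative
        - 1\<^sup>2 * y x i + g (y x) i) (at x)"
      using rho[OF i] by (auto intro!: derivative_eq_intros simp: numeral_2_eq_2 of_nat_diff)
  qed
  have field_Y: "h\<^sup>2 * tree_field (tr i) (\<lambda>s. Y h j (idx s)) = h ^ rho (tr i) * psi'' (c h) (A h) (tr i) j"
    if "i < d" for i h j
    using that by (simp add: Y_def field_lift tree_field_scale psi''_tree_field)
  have stages: "stage_equations (c h) (A h) d 1 g y 0 h (Y h)" for h
    unfolding stage_equations_def
  proof (intro allI conjI impI)
    show "Y h j \<in> Rd d" for j by (simp add: Y_def Rd)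
    fix j i assume i: "i < d"
    define r where "r = rho (tr i)"
    \<comment> \<open>Every order is at least 1, so \<open>y 0 i = 0\<close> and only the value at
      -h survives; its sign is the alternating sign in the recursion for \<open>psi\<close>.\<close>
    have "y (0 - h) i + (1 + c h $ j) * (y 0 i - y (0 - h) i) = - c h $ j * (- h) ^ r"
      using rho[OF i] i by (simp add: y_def lift_def r_def power_0_left algebra_simps)
    also have "\<dots> = h ^ r * ((-1) ^ (r + 1) * c h $ j)"
      by (simp add: power_minus[of h])
    finally have 1: "y (0 - h) i + (1 + c h $ j) * (y 0 i - y (0 - h) i) = h ^ r * ((-1) ^ (r + 1) * c h $ j)" .
    have "h\<^sup>2 * (\<Sum>k\<in>UNIV. A h $ j $ k * (- 1\<^sup>2 * Y h k i + g (Y h k) i))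
      = (\<Sum>k\<in>UNIV. A h $ j $ k * (h\<^sup>2 * tree_field (tr i) (\<lambda>s. Y h k (idx s))))"
      using i by (simp add: g_def sum_distrib_left mult_ac)
    also have "\<dots> = h ^ r * (\<Sum>k\<in>UNIV. A h $ j $ k * psi'' (c h) (A h) (tr i) k)"
      using i by (simp add: field_Y r_def sum_distrib_left mult_ac)
    finally have 2: "h\<^sup>2 * (\<Sum>k\<in>UNIV. A h $ j $ k * (- 1\<^sup>2 * Y h k i + g (Y h k) i))
      = h ^ r * (\<Sum>k\<in>UNIV. A h $ j $ k * psi'' (c h) (A h) (tr i) k)" .
    show "Y h j i = y (0 - h) i + (1 + c h $ j) * (y 0 i - y (0 - h) i)
       + h\<^sup>2 * (\<Sum>k\<in>UNIV. A h $ j $ k * (- 1\<^sup>2 * Y h k i + g (Y h k) i))"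
      unfolding 1 2 using i
      by (simp only: Y_def lift_def r_def psi_nonempty[OF nonempty[OF i]] distrib_left if_True)
  qed
  have limits: "((\<lambda>h. Y h j i) \<longlongrightarrow> y 0 i) (at_right 0)" if "i < d" for j i
  proof -
    have "(\<lambda>h. h ^ rho (tr i) * psi (c h) (A h) (tr i) j) \<in> O[at_right 0](\<lambda>h. h ^ rho (tr i) * 1)"
      by (intro landau_o.big.mult_left psi_bigo_1 bounded)
    moreover have "((\<lambda>h::real. h ^ rho (tr i) * 1) \<longlongrightarrow> 0) (at_right 0)"
      using rho[OF that] by (auto intro!: tendsto_eq_intros)
    ultimately have "((\<lambda>h. h ^ rho (tr i) * psi (c h) (A h) (tr i) j) \<longlongrightarrow> 0) (at_right 0)"
      by (rule tendsto_zero_bigo)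
    then show ?thesis
      using that rho[OF that] by (simp add: Y_def y_def lift_def power_0_left)
  qed
  obtain k where k: "\<And>d \<omega> g y \<alpha> \<beta> x0 (n::nat) Y.
     \<omega> > 0 \<and> perturbation d k g \<and> solves_oscillator d \<omega> g y {\<alpha><..<\<beta>} \<and> x0 \<in> {\<alpha><..<\<beta>} \<and>
     (\<forall>\<^sub>F h in at_right 0. stage_equations (c (\<omega> * h)) (A (\<omega> * h)) d \<omega> g y (x0 + n * h) h (Y h)) \<and>
     (\<forall>j. \<forall>i<d. ((\<lambda>h. Y h j i) \<longlongrightarrow> y x0 i) (at_right 0)) \<Longrightarrow>
     (\<forall>i<d. (\<lambda>h. norm (local_error (b (\<omega> * h)) \<omega> g y (x0 + n * h) h (Y h) i))
               \<in> O[at_right 0](\<lambda>h. h ^ q))"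
    using order unfolding local_error_order_def by blast
  define r where "r = rho t"
  \<comment> \<open>The term with \<open>h\<^sup>2 * psi\<close> stems from the summand u of g, the
    one with \<open>psi''\<close> from f. The constant comes from y(h) + y(-h) = h^r + (-h)^r, the
    cosine term being multiplied by y(0) = 0.\<close>
  define E where "E h = (\<Sum>j\<in>UNIV. b h $ j * (psi'' (c h) (A h) t j + h\<^sup>2 * psi (c h) (A h) t j)) - (1 + (-1) ^ r)" for h
  have r: "1 \<le> r" "r \<le> q" using rho_pos t le by (simp_all add: r_def)
  have "(\<lambda>h. norm (local_error (b (1 * h)) 1 g y (0 + real 0 * h) h (Y h) (idx t))) \<in> O[at_right 0](\<lambda>h. h ^ q)"
    using k[of 1 d g y "-1" 1 0 0 Y] pert sol stages limits idx[OF S(2)] by simp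
  moreover have "\<forall>\<^sub>F h in at_right 0. norm (local_error (b (1 * h)) 1 g y (0 + real 0 * h) h (Y h) (idx t))
     = norm (h ^ (r - 1) * E h)"
    using eventually_at_right_less[of "0::real"]
  proof eventually_elim
    case (elim h)
    define T where "T = (\<Sum>j\<in>UNIV. b h $ j * (psi'' (c h) (A h) t j + h\<^sup>2 * psi (c h) (A h) t j))"
    have hr: "h ^ r = h * h ^ (r - 1)"
      using r by (simp add: power_eq_if)
    have "h\<^sup>2 * (\<Sum>j\<in>UNIV. b h $ j * g (Y h j) (idx t)) = h ^ r * T"
      using field_Y[OF idx(1)[OF S(2)], of h] idx[OF S(2)]
      by (simp add: g_def T_def Y_def lift_def sum_distrib_left distrib_left r_def algebra_simps)
    then have "h * (\<Sum>j\<in>UNIV. b h $ j * g (Y h j) (idx t)) = h ^ (r - 1) * T"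
      using elim unfolding hr by (simp add: power2_eq_square mult_ac)
    moreover have "(y h (idx t) - 2 * cos h * y 0 (idx t) + y (- h) (idx t)) / h = h ^ (r - 1) * (1 + (-1) ^ r)"
      using elim r idx[OF S(2)] power_minus[of h r]
      by (simp add: y_def lift_def power_0_left flip: r_def) (simp add: hr add_divide_distrib algebra_simps)
    ultimately have "norm (local_error (b h) 1 g y 0 h (Y h) (idx t)) = \<bar>h ^ (r - 1) * (1 + (-1) ^ r) - h ^ (r - 1) * T\<bar>"
      using elim norm_local_error[of 1 h "b h" g y 0 "Y h" "idx t"] by simp
    also have "\<dots> = norm (h ^ (r - 1) * E h)"
      by (simp add: E_def T_def abs_mult abs_minus_commute flip: right_diff_distrib)
    finally show ?case by simp
  qed
  ultimately have "(\<lambda>h. norm (h ^ (r - 1) * E h)) \<in> O[at_right 0](\<lambda>h. h ^ q)"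
    by (subst (asm) landau_o.big.in_cong)
  then have "(\<lambda>h. h ^ (r - 1) * E h) \<in> O[at_right 0](\<lambda>h. h ^ q)"
    by (simp only: real_norm_def landau_o.big.abs_in_iff)
  moreover have "h ^ q = h ^ (r - 1) * h ^ (q + 1 - r)" for h :: real
    using r by (simp flip: power_add)
  ultimately have "(\<lambda>h. h ^ (r - 1) * E h) \<in> O[at_right 0](\<lambda>h. h ^ (r - 1) * h ^ (q + 1 - r))"
    by simp
  moreover have "\<forall>\<^sub>F h::real in at_right 0. h ^ (r - 1) \<noteq> 0"
    using eventually_at_right_less[of "0::real"] by eventually_elim simp
  ultimately have "E \<in> O[at_right 0](\<lambda>h. h ^ (q + 1 - r))"
    by (subst (asm) landau_o.big.mult_cancel_left) auto
  then show ?thesis by (simp add: E_def[abs_def] r_def)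
qed

lemma power_bigo_at_right_0:
  assumes "m \<le> n"
  shows "(\<lambda>h::real. h ^ n) \<in> O[at_right 0](\<lambda>h. h ^ m)"
proof -
  have "\<forall>\<^sub>F h::real in at_right 0. h < 1"
    by (rule eventually_at_right_real[THEN eventually_mono]) auto
  with eventually_at_right_less[of "0::real"]
  have "\<forall>\<^sub>F h::real in at_right 0. norm (h ^ n) \<le> 1 * norm (h ^ m)"
    by eventually_elim (use assms in \<open>simp add: power_decreasing\<close>)
  then show ?thesis by (rule bigoI)
qed

lemma order_condition_of_local_error_order:
  fixes c b :: "real \<Rightarrow> real ^ 's" and A :: "real \<Rightarrow> real ^ 's ^ 's"
  assumes bounded: "Bfun c (at_right 0)" "Bfun A (at_right 0)" "Bfun b (at_right 0)"
    and order: "local_error_order c A b q"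
  shows "t \<in> T2 \<Longrightarrow> t \<noteq> EmptyTree \<Longrightarrow> rho t \<le> q \<Longrightarrow> order_condition c A b q t"
proof (induction "q - rho t" arbitrary: t rule: less_induct)
  case less
  define r where "r = rho t"
  have "r \<le> q" using less.prems by (simp add: r_def)
  define E where "E h = (\<Sum>j\<in>UNIV. b h $ j * (psi'' (c h) (A h) t j + h\<^sup>2 * psi (c h) (A h) t j)) - (1 + (-1) ^ r)" for h
  \<comment> \<open>Up to the factor (r + 2)(r + 1) this is the defect in the condition of the tree
    \<open>Node {#t#}\<close>. It is normalised so that \<open>E h - h\<^sup>2 * G h\<close> becomes
    the defect of t itself once \<open>phi_recurrence\<close> is applied.\<close>
  define G where "G h = (\<Sum>j\<in>UNIV. b h $ j * psi (c h) (A h) t j) - (1 + (-1) ^ r) * fact r * phi (Suc (Suc r)) h" for h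
  have E: "E \<in> O[at_right 0](\<lambda>h. h ^ (q + 1 - r))"
    using local_error_order_test_problem[OF bounded(1,2) order less.prems] by (simp add: E_def[abs_def] r_def)
  have "(\<lambda>h. h\<^sup>2 * G h) \<in> O[at_right 0](\<lambda>h. h ^ (q + 1 - r))"
  proof (cases "r + 2 \<le> q")
    case True
    have "Node {#t#} \<in> T2" using less.prems by (intro T2.intros) auto
    moreover have rho: "rho (Node {#t#}) = Suc (Suc r)" by (simp add: r_def)
    ultimately have "order_condition c A b q (Node {#t#})"
      using less True by (simp add: r_def)
    moreover have "b h \<bullet> psi''_vec (c h) (A h) (Node {#t#})
        - (1 + (-1) ^ Suc (Suc r)) * fact (Suc (Suc r)) * phi (Suc (Suc r)) h
        = (real r + 2) * (real r + 1) * G h" for h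
    proof -
      have "b h \<bullet> psi''_vec (c h) (A h) (Node {#t#})
          = (real r + 2) * (real r + 1) * (\<Sum>j\<in>UNIV. b h $ j * psi (c h) (A h) t j)"
        using rho
        by (simp add: psi''_vec_def inner_vec_def sum_distrib_left r_def mult_ac) (simp add: add_ac)
      then show ?thesis
        by (simp add: G_def algebra_simps del: phi.simps)
    qed
    ultimately have "(\<lambda>h. (real r + 2) * (real r + 1) * G h) \<in> O[at_right 0](\<lambda>h. h ^ (q + 1 - Suc (Suc r)))"
      unfolding order_condition_def rho by simp
    then have "G \<in> O[at_right 0](\<lambda>h. h ^ (q + 1 - Suc (Suc r)))"
      by (subst (asm) cmult_in_bigo_iff) (simp add: add_eq_0_iff)
    then have "(\<lambda>h. h\<^sup>2 * G h) \<in> O[at_right 0](\<lambda>h. h\<^sup>2 * h ^ (q + 1 - Suc (Suc r)))"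
      by (rule landau_o.big.mult_left)
    moreover have "2 + (q + 1 - Suc (Suc r)) = q + 1 - r" using True by simp
    ultimately show ?thesis by (simp only: flip: power_add)
  next
    \<comment> \<open>Here the induction hypothesis is out of reach, but q + 1 - r is at most 2, so
      boundedness of \<open>G\<close> is enough.\<close>
    case False
    have "G \<in> O[at_right 0](\<lambda>_. 1)"
      unfolding G_def
      by (intro sum_in_bigo big_sum_in_bigo landau_o.big.mult_in_1 bigo_const phi_Suc_Suc_bigo
          Bfun_vec_nth_bigo psi_bigo_1 bounded)
    then have "(\<lambda>h. h\<^sup>2 * G h) \<in> O[at_right 0](\<lambda>h. h\<^sup>2 * 1)"
      by (rule landau_o.big.mult_left)
    also have "(\<lambda>h::real. h\<^sup>2 * 1) \<in> O[at_right 0](\<lambda>h. h ^ (q + 1 - r))"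
      using False power_bigo_at_right_0[of "q + 1 - r" 2] by simp
    finally show ?thesis .
  qed
  with E have "(\<lambda>h. E h - h\<^sup>2 * G h) \<in> O[at_right 0](\<lambda>h. h ^ (q + 1 - r))"
    by (rule sum_in_bigo)
  moreover have "\<forall>\<^sub>F h in at_right 0. E h - h\<^sup>2 * G h
      = b h \<bullet> psi''_vec (c h) (A h) t - (1 + (-1) ^ r) * fact r * phi r h"
    using eventually_at_right_less[of "0::real"]
  proof eventually_elim
    case (elim h)
    have "fact r * phi r h = 1 - h\<^sup>2 * fact r * phi (Suc (Suc r)) h"
      by (subst phi_recurrence[OF elim]) (simp add: algebra_simps del: phi.simps)
    then have "(1 + (-1) ^ r) * fact r * phi r h = (1 + (-1) ^ r) * (1 - h\<^sup>2 * fact r * phi (Suc (Suc r)) h)"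
      by (simp only: mult.assoc)
    then show ?case
      by (simp add: E_def G_def psi''_vec_def inner_vec_def distrib_left sum.distrib sum_distrib_left
          algebra_simps del: phi.simps)
  qed
  ultimately show ?case
    unfolding order_condition_def r_def by (subst (asm) landau_o.big.in_cong)
qed


section \<open>Forest expansions\<close>

text \<open>The window reaches from x_n - h to x_n + h, the stretch of the solution that enters one
  step. Continuity is included because remainders are integrated over this window, and splitting
  such integrals needs integrability.\<close>

definition uniform_bound :: "nat \<Rightarrow> (real \<Rightarrow> real \<Rightarrow> real) \<Rightarrow> bool" where
  "uniform_bound N u \<longleftrightarrow> (\<exists>C. \<forall>\<^sub>F h in at_right 0.
     continuous_on {-h..h} (u h) \<and> (\<forall>x\<in>{-h..h}. \<bar>u h x\<bar> \<le> C * h ^ N))"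

lemma uniform_bound_continuous:
  "uniform_bound N u \<Longrightarrow> \<forall>\<^sub>F h in at_right 0. continuous_on {-h..h} (u h)"
  unfolding uniform_bound_def by (auto elim: eventually_mono)

lemma uniform_bound_add:
  assumes "uniform_bound N u" "uniform_bound N v"
  shows "uniform_bound N (\<lambda>h x. u h x + v h x)"
proof -
  obtain C where C: "\<forall>\<^sub>F h in at_right 0. continuous_on {-h..h} (u h) \<and> (\<forall>x\<in>{-h..h}. \<bar>u h x\<bar> \<le> C * h ^ N)"
    using assms(1) unfolding uniform_bound_def by blast
  obtain D where D: "\<forall>\<^sub>F h in at_right 0. continuous_on {-h..h} (v h) \<and> (\<forall>x\<in>{-h..h}. \<bar>v h x\<bar> \<le> D * h ^ N)"
    using assms(2) unfolding uniform_bound_def by blast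
  have "\<forall>\<^sub>F h in at_right 0. continuous_on {-h..h} (\<lambda>x. u h x + v h x)
      \<and> (\<forall>x\<in>{-h..h}. \<bar>u h x + v h x\<bar> \<le> (C + D) * h ^ N)"
    using C D
  proof eventually_elim
    case (elim h)
    have "\<bar>u h x + v h x\<bar> \<le> (C + D) * h ^ N" if "x \<in> {-h..h}" for x
      unfolding distrib_right using elim that by (intro order_trans[OF abs_triangle_ineq] add_mono) auto
    with elim show ?case by (auto intro: continuous_on_add)
  qed
  then show ?thesis unfolding uniform_bound_def by blast
qed

lemma uniform_bound_mult:
  assumes "uniform_bound M u" "uniform_bound N v"
  shows "uniform_bound (M + N) (\<lambda>h x. u h x * v h x)"
proof -
  obtain C where C: "\<forall>\<^sub>F h in at_right 0. continuous_on {-h..h} (u h) \<and> (\<forall>x\<in>{-h..h}. \<bar>u h x\<bar> \<le> C * h ^ M)"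
    using assms(1) unfolding uniform_bound_def by blast
  obtain D where D: "\<forall>\<^sub>F h in at_right 0. continuous_on {-h..h} (v h) \<and> (\<forall>x\<in>{-h..h}. \<bar>v h x\<bar> \<le> D * h ^ N)"
    using assms(2) unfolding uniform_bound_def by blast
  have "\<forall>\<^sub>F h in at_right 0. continuous_on {-h..h} (\<lambda>x. u h x * v h x)
      \<and> (\<forall>x\<in>{-h..h}. \<bar>u h x * v h x\<bar> \<le> (C * D) * h ^ (M + N))"
    using C D
  proof eventually_elim
    case (elim h)
    have "\<bar>u h x * v h x\<bar> \<le> (C * D) * h ^ (M + N)" if "x \<in> {-h..h}" for x
    proof -
      have *: "\<bar>u h x\<bar> \<le> C * h ^ M" "\<bar>v h x\<bar> \<le> D * h ^ N" using elim that by auto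
      have "\<bar>u h x * v h x\<bar> \<le> (C * h ^ M) * (D * h ^ N)"
        unfolding abs_mult using * by (intro mult_mono) auto
      then show ?thesis by (simp add: power_add mult_ac)
    qed
    with elim show ?case by (auto intro: continuous_on_mult)
  qed
  then show ?thesis unfolding uniform_bound_def by blast
qed

lemma uniform_bound_antimono:
  assumes "uniform_bound N u" "M \<le> N"
  shows "uniform_bound M u"
proof -
  obtain C where C: "\<forall>\<^sub>F h in at_right 0. continuous_on {-h..h} (u h) \<and> (\<forall>x\<in>{-h..h}. \<bar>u h x\<bar> \<le> C * h ^ N)"
    using assms(1) unfolding uniform_bound_def by blast
  have "\<forall>\<^sub>F h::real in at_right 0. h < 1"
    by (rule eventually_at_right_real[THEN eventually_mono]) auto
  with eventually_at_right_less[of "0::real"] C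
  have "\<forall>\<^sub>F h in at_right 0. continuous_on {-h..h} (u h) \<and> (\<forall>x\<in>{-h..h}. \<bar>u h x\<bar> \<le> \<bar>C\<bar> * h ^ M)"
  proof eventually_elim
    case (elim h)
    have "C * h ^ N \<le> \<bar>C\<bar> * h ^ M"
      using elim assms(2) by (intro mult_mono power_decreasing) auto
    with elim show ?case by (auto intro: order_trans)
  qed
  then show ?thesis unfolding uniform_bound_def by blast
qed

lemma uniform_bound_monomial:
  assumes "\<kappa> \<in> O[at_right 0](\<lambda>_. 1)"
  shows "uniform_bound m (\<lambda>h x. \<kappa> h * x ^ m)"
proof -
  obtain C where "\<forall>\<^sub>F h in at_right 0. norm (\<kappa> h) \<le> C * norm (1::real)"
    using assms by (rule landau_o.bigE)
  then have "\<forall>\<^sub>F h in at_right 0. continuous_on {-h..h} (\<lambda>x. \<kappa> h * x ^ m) \<and> (\<forall>x\<in>{-h..h}. \<bar>\<kappa> h * x ^ m\<bar> \<le> C * h ^ m)"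
  proof eventually_elim
    case (elim h)
    have "\<bar>\<kappa> h * x ^ m\<bar> \<le> C * h ^ m" if "x \<in> {-h..h}" for x
    proof -
      have "\<bar>x\<bar> ^ m \<le> h ^ m" using that by (intro power_mono) auto
      then show ?thesis
        unfolding abs_mult power_abs using elim by (intro mult_mono) auto
    qed
    then show ?case by (auto intro!: continuous_intros)
  qed
  then show ?thesis unfolding uniform_bound_def by blast
qed

lemma uniform_bound_at:
  assumes "uniform_bound N u" "\<forall>\<^sub>F h in at_right 0. \<xi> h \<in> {-h..h}"
  shows "(\<lambda>h. u h (\<xi> h)) \<in> O[at_right 0](\<lambda>h. h ^ N)"
proof -
  obtain C where C: "\<forall>\<^sub>F h in at_right 0. continuous_on {-h..h} (u h) \<and> (\<forall>x\<in>{-h..h}. \<bar>u h x\<bar> \<le> C * h ^ N)"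
    using assms(1) unfolding uniform_bound_def by blast
  have "\<forall>\<^sub>F h in at_right 0. norm (u h (\<xi> h)) \<le> C * norm (h ^ N)"
    using C assms(2) eventually_at_right_less[of "0::real"] by eventually_elim simp
  then show ?thesis by (rule bigoI)
qed

lemma continuous_on_scaled:
  assumes "continuous_on {-h..h} u" "\<bar>x\<bar> \<le> (h::real)"
  shows "continuous_on {0..1} (\<lambda>z::real. u (x * z) :: real)"
proof (rule continuous_on_compose2[OF assms(1)])
  show "(\<lambda>z. x * z) ` {0..1} \<subseteq> {-h..h}"
  proof (rule image_subsetI)
    fix z :: real assume "z \<in> {0..1}"
    then have "\<bar>x * z\<bar> \<le> h * 1" using assms(2) unfolding abs_mult by (intro mult_mono) auto
    then show "x * z \<in> {-h..h}" by auto
  qed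
qed (auto intro!: continuous_intros)

text \<open>For \<open>w'' = u\<close> this is \<open>w(x\<^sub>n + x) - w(x\<^sub>n) - x w'(x\<^sub>n)\<close>, by Taylor's formula.\<close>

definition taylor_remainder :: "(real \<Rightarrow> real \<Rightarrow> real) \<Rightarrow> real \<Rightarrow> real \<Rightarrow> real" where
  "taylor_remainder u h x = x\<^sup>2 * integral {0..1} (\<lambda>z. (1 - z) * u h (x * z))"

lemma taylor_remainder_add:
  assumes "continuous_on {-h..h} (u h)" "continuous_on {-h..h} (v h)" "\<bar>x\<bar> \<le> h"
  shows "taylor_remainder (\<lambda>h x. u h x + v h x) h x = taylor_remainder u h x + taylor_remainder v h x"
proof -
  have "(\<lambda>z. (1 - z) * w (x * z)) integrable_on {0..1}" if "continuous_on {-h..h} w" for w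
    by (intro integrable_continuous_real continuous_intros continuous_on_scaled[OF that assms(3)])
  with assms show ?thesis
    by (simp add: taylor_remainder_def distrib_left integral_add)
qed

text \<open>With \<rho> = m + 2 the denominator is \<rho>(\<rho> - 1), the very factor by which
  \<open>psi''\<close> exceeds the product over the children; the two cancel when forests are
  integrated.\<close>

lemma taylor_remainder_monomial:
  "taylor_remainder (\<lambda>h x. \<kappa> h * x ^ m) h x = \<kappa> h / ((real m + 1) * (real m + 2)) * x ^ (m + 2)"
proof -
  define W where "W z = \<kappa> h * x ^ m * (z ^ (m + 1) / (real m + 1) - z ^ (m + 2) / (real m + 2))" for z
  have "((\<lambda>z. (1 - z) * (\<kappa> h * (x * z) ^ m)) has_integral W 1 - W 0) {0..1}"
  proof (rule fundamental_theorem_of_calculus)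
    fix z :: real
    have "(W has_real_derivative \<kappa> h * x ^ m * ((real m + 1) * z ^ m / (real m + 1)
        - (real m + 2) * z ^ (m + 1) / (real m + 2))) (at z within {0..1})"
      unfolding W_def
      by (rule DERIV_cong[OF DERIV_cmult[OF DERIV_diff[OF DERIV_cdivide[OF DERIV_pow] DERIV_cdivide[OF DERIV_pow]]]])
        (simp add: add_ac)
    moreover have "\<kappa> h * x ^ m * ((real m + 1) * z ^ m / (real m + 1)
        - (real m + 2) * z ^ (m + 1) / (real m + 2)) = (1 - z) * (\<kappa> h * (x * z) ^ m)"
    proof -
      have "real m + 1 \<noteq> 0" "real m + 2 \<noteq> 0"
        using of_nat_0_le_iff[of m, where 'a = real] by linarith+
      then have *: "(real m + 1) * z ^ m / (real m + 1) = z ^ m"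
        "(real m + 2) * z ^ (m + 1) / (real m + 2) = z * z ^ m"
        by simp_all
      show ?thesis unfolding * by (simp add: power_mult_distrib algebra_simps)
    qed
    ultimately show "(W has_vector_derivative (1 - z) * (\<kappa> h * (x * z) ^ m)) (at z within {0..1})"
      by (simp only: has_real_derivative_iff_has_vector_derivative)
  qed simp
  moreover have "x\<^sup>2 * (W 1 - W 0) = \<kappa> h / ((real m + 1) * (real m + 2)) * x ^ (m + 2)"
  proof -
    have "1 / (real m + 1) - 1 / (real m + 2) = 1 / ((real m + 1) * (real m + 2))"
      by (simp add: divide_simps)
    then have "W 1 - W 0 = \<kappa> h * x ^ m * (1 / ((real m + 1) * (real m + 2)))"
      by (simp add: W_def)
    then show ?thesis by (simp add: power_add power2_eq_square)
  qed
  ultimately show ?thesis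
    unfolding taylor_remainder_def by (simp add: integral_unique)
qed

text \<open>The prefactor \<open>x\<^sup>2\<close>, at most \<open>h\<^sup>2\<close> on the window,
  is the gain of two orders on which the bootstrap lives.\<close>

lemma uniform_bound_taylor_remainder:
  assumes "uniform_bound N u"
  shows "uniform_bound (N + 2) (taylor_remainder u)"
proof -
  obtain C where C: "\<forall>\<^sub>F h in at_right 0. continuous_on {-h..h} (u h) \<and> (\<forall>x\<in>{-h..h}. \<bar>u h x\<bar> \<le> C * h ^ N)"
    using assms(1) unfolding uniform_bound_def by blast
  have "\<forall>\<^sub>F h in at_right 0. continuous_on {-h..h} (taylor_remainder u h) \<and>
      (\<forall>x\<in>{-h..h}. \<bar>taylor_remainder u h x\<bar> \<le> C * h ^ (N + 2))"
    using C eventually_at_right_less[of "0::real"]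
  proof eventually_elim
    case (elim h)
    have scaled: "x * z \<in> {-h..h}" if "x \<in> {-h..h}" "z \<in> {0..1}" for x z :: real
    proof -
      have "\<bar>x * z\<bar> \<le> h * 1" using that unfolding abs_mult by (intro mult_mono) auto
      then show ?thesis by auto
    qed
    have "continuous_on {-h..h} (\<lambda>x. x\<^sup>2 * integral (cbox 0 1) (\<lambda>z. (1 - z) * u h (x * z)))"
    proof (intro continuous_intros integral_continuous_on_param)
      have "continuous_on ({-h..h} \<times> cbox 0 1) (\<lambda>p. u h (fst p * snd p))"
        by (rule continuous_on_compose2[of "{-h..h}" "u h"])
          (use elim scaled in \<open>auto intro!: continuous_intros\<close>)
      then show "continuous_on ({-h..h} \<times> cbox 0 1) (\<lambda>(x, z). (1 - z) * u h (x * z))"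
        unfolding case_prod_beta by (intro continuous_intros)
    qed
    moreover have "\<bar>taylor_remainder u h x\<bar> \<le> C * h ^ (N + 2)" if x: "x \<in> {-h..h}" for x
    proof -
      have "norm (integral {0..1} (\<lambda>z. (1 - z) * u h (x * z))) \<le> (C * h ^ N) * (1 - 0)"
      proof (rule integral_bound)
        show "continuous_on {0..1} (\<lambda>z. (1 - z) * u h (x * z))"
          using elim x by (intro continuous_intros continuous_on_scaled[of h]) auto
        fix z :: real assume z: "z \<in> {0..1}"
        have "\<bar>1 - z\<bar> * \<bar>u h (x * z)\<bar> \<le> 1 * (C * h ^ N)"
          using z elim scaled[OF x z] by (intro mult_mono) auto
        then show "norm ((1 - z) * u h (x * z)) \<le> C * h ^ N"
          by (simp add: abs_mult)
      qed simp
      moreover have "x\<^sup>2 \<le> h\<^sup>2" using x elim by (intro power2_le_iff_abs_le[THEN iffD2]) auto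
      ultimately have "x\<^sup>2 * \<bar>integral {0..1} (\<lambda>z. (1 - z) * u h (x * z))\<bar> \<le> h\<^sup>2 * (C * h ^ N)"
        by (intro mult_mono) auto
      then show ?thesis
        by (simp add: taylor_remainder_def abs_mult power_add power2_eq_square mult_ac)
    qed
    ultimately show ?case
      by (simp add: taylor_remainder_def[abs_def])
  qed
  then show ?thesis unfolding uniform_bound_def by blast
qed

text \<open>\<open>u h x\<close> stands for a quantity along the exact solution at \<open>x\<^sub>n + x\<close>, and \<open>U h j\<close> for its
  counterpart at the \<open>j\<close>-th stage: both have the same coefficients with respect to forests.\<close>

inductive forest_expansion ::
    "(real \<Rightarrow> real ^ 's) \<Rightarrow> (real \<Rightarrow> real ^ 's ^ 's) \<Rightarrow> nat \<Rightarrow>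
      (real \<Rightarrow> real \<Rightarrow> real) \<Rightarrow> (real \<Rightarrow> 's \<Rightarrow> real) \<Rightarrow> bool"
  for c A N where
  forest: "(\<And>t. t \<in># ts \<Longrightarrow> t \<in> T2 \<and> t \<noteq> EmptyTree) \<Longrightarrow> \<kappa> \<in> O[at_right 0](\<lambda>_. 1) \<Longrightarrow>
    forest_expansion c A N (\<lambda>h x. \<kappa> h * x ^ (\<Sum>t\<in>#ts. rho t))
      (\<lambda>h j. \<kappa> h * (h ^ (\<Sum>t\<in>#ts. rho t) * (\<Prod>t\<in>#ts. psi (c h) (A h) t j)))"
| remainder: "uniform_bound N r \<Longrightarrow> (\<And>j. (\<lambda>h. R h j) \<in> O[at_right 0](\<lambda>h. h ^ N)) \<Longrightarrow>
    forest_expansion c A N r R"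
| sum: "forest_expansion c A N u U \<Longrightarrow> forest_expansion c A N v V \<Longrightarrow>
    forest_expansion c A N (\<lambda>h x. u h x + v h x) (\<lambda>h j. U h j + V h j)"

text \<open>The relation speaks about functions for all h and x, while identities hold only
  eventually and on the window. Their difference is a remainder with bound 0 and can be
  absorbed.\<close>

lemma forest_expansion_cong:
  assumes "forest_expansion c A N u U"
    and u: "\<forall>\<^sub>F h in at_right 0. \<forall>x\<in>{-h..h}. v h x = u h x"
    and U: "\<And>j. \<forall>\<^sub>F h in at_right 0. V h j = U h j"
  shows "forest_expansion c A N v V"
proof -
  have "uniform_bound N (\<lambda>h x. v h x - u h x)"
    unfolding uniform_bound_def
  proof (rule exI[of _ 0], use u in eventually_elim)
    case (elim h)
    then have "continuous_on {-h..h} (\<lambda>x. v h x - u h x) \<longleftrightarrow> continuous_on {-h..h} (\<lambda>x. 0 :: real)"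
      by (intro continuous_on_cong) auto
    with elim show ?case by simp
  qed
  moreover have "(\<lambda>h. V h j - U h j) \<in> O[at_right 0](\<lambda>h. h ^ N)" for j
  proof -
    have "\<forall>\<^sub>F h in at_right 0. norm (V h j - U h j) \<le> 0 * norm (h ^ N)"
      using U[of j] by eventually_elim simp
    then show ?thesis by (rule bigoI)
  qed
  ultimately have "forest_expansion c A N (\<lambda>h x. v h x - u h x) (\<lambda>h j. V h j - U h j)"
    by (rule forest_expansion.remainder)
  from forest_expansion.sum[OF assms(1) this] show ?thesis by simp
qed

lemma forest_expansion_const:
  assumes "\<kappa> \<in> O[at_right 0](\<lambda>_. 1)"
  shows "forest_expansion c A N (\<lambda>h x. \<kappa> h) (\<lambda>h j. \<kappa> h)"
  using forest_expansion.forest[of "{#}" \<kappa> c A N] assms by simp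

context
  fixes c :: "real \<Rightarrow> real ^ 's" and A :: "real \<Rightarrow> real ^ 's ^ 's"
  assumes bounded_c: "Bfun c (at_right 0)" and bounded_A: "Bfun A (at_right 0)"
begin

lemma forest_expansion_bounded:
  assumes "forest_expansion c A N u U"
  shows "uniform_bound 0 u" "(\<lambda>h. U h j) \<in> O[at_right 0](\<lambda>_. 1)"
  using assms
proof (induction)
  case (forest ts \<kappa>)
  {
    case 1
    show ?case using uniform_bound_antimono[OF uniform_bound_monomial] forest(2) by blast
  next
    case 2
    show ?case
      using power_bigo_at_right_0[of 0] forest(2)
      by (intro landau_o.big.mult_in_1 prod_mset_bigo_1 psi_bigo_1 bounded_c bounded_A) auto
  }
next
  case (remainder r R)
  {
    case 1
    show ?case using uniform_bound_antimono remainder(1) by blast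
  next
    case 2
    show ?case
      using landau_o.big_trans[OF remainder(2) power_bigo_at_right_0[of 0]] by simp
  }
qed (auto intro: uniform_bound_add sum_in_bigo)

text \<open>Forests multiply by disjoint union, under which orders add and products of
  \<open>psi\<close> multiply. A remainder times anything bounded is again a remainder.\<close>

lemma forest_expansion_mult:
  assumes "forest_expansion c A N u U" "forest_expansion c A N v V"
  shows "forest_expansion c A N (\<lambda>h x. u h x * v h x) (\<lambda>h j. U h j * V h j)"
  using assms(1)
proof (induction)
  case (forest ts \<kappa>)
  note ts = forest
  show ?case
    using assms(2)
  proof (induction)
    case (forest ss \<mu>)
    have "forest_expansion c A N (\<lambda>h x. \<kappa> h * \<mu> h * x ^ (\<Sum>t\<in>#ts + ss. rho t))
      (\<lambda>h j. \<kappa> h * \<mu> h * (h ^ (\<Sum>t\<in>#ts + ss. rho t) * (\<Prod>t\<in>#ts + ss. psi (c h) (A h) t j)))"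
      using ts forest by (intro forest_expansion.forest landau_o.big.mult_in_1) auto
    then show ?case by (simp add: power_add mult_ac)
  next
    case (remainder r R)
    have e: "forest_expansion c A N (\<lambda>h x. \<kappa> h * x ^ (\<Sum>t\<in>#ts. rho t))
      (\<lambda>h j. \<kappa> h * (h ^ (\<Sum>t\<in>#ts. rho t) * (\<Prod>t\<in>#ts. psi (c h) (A h) t j)))"
      using ts by (rule forest_expansion.forest)
    show ?case
      using uniform_bound_mult[OF forest_expansion_bounded(1)[OF e] remainder(1)]
        landau_o.big.mult[OF forest_expansion_bounded(2)[OF e] remainder(2)]
      by (intro forest_expansion.remainder) simp_all
  next
    case (sum u U v V)
    show ?case
      using forest_expansion.sum[OF sum.IH] by (simp add: distrib_left)
  qed
next
  case (remainder r R)
  show ?case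
    using uniform_bound_mult[OF remainder(1) forest_expansion_bounded(1)[OF assms(2)]]
      landau_o.big.mult[OF remainder(2) forest_expansion_bounded(2)[OF assms(2)]]
    by (intro forest_expansion.remainder) simp_all
next
  case (sum u U v V)
  show ?case
    using forest_expansion.sum[OF sum.IH] by (simp add: distrib_right)
qed

lemma forest_expansion_power:
  "forest_expansion c A N u U \<Longrightarrow> forest_expansion c A N (\<lambda>h x. u h x ^ e) (\<lambda>h j. U h j ^ e)"
  by (induction e) (auto intro: forest_expansion_mult forest_expansion_const)

lemma forest_expansion_prod:
  fixes d :: nat
  assumes "\<And>i. i < d \<Longrightarrow> forest_expansion c A N (u i) (U i)"
  shows "forest_expansion c A N (\<lambda>h x. \<Prod>i<d. u i h x) (\<lambda>h j. \<Prod>i<d. U i h j)"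
  using assms by (induction d) (auto intro: forest_expansion_mult forest_expansion_const)

text \<open>Double integration joins a forest to a common root and turns it into a forest of one
  tree t. On the stage side the matrix term and the term in \<open>c\<close> are the two summands in
  the recursion for \<open>psi\<close> at t, so the coefficients agree again. The expression on the
  stage side is what remains of the stage equation after y(x_n) and the part linear in h are split
  off.\<close>

lemma forest_expansion_taylor_remainder:
  assumes "forest_expansion c A N u U"
  shows "forest_expansion c A (N + 2) (taylor_remainder u)
    (\<lambda>h j. h\<^sup>2 * (\<Sum>k\<in>UNIV. A h $ j $ k * U h k) - c h $ j * taylor_remainder u h (- h))"
  using assms
proof (induction)
  case (forest ts \<kappa>)
  define m where "m = (\<Sum>t\<in>#ts. rho t)"
  \<comment> \<open>\<open>Tau\<close> acts as the root above the empty forest, since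
    \<open>Node {#}\<close> is outside \<open>T2\<close>; its data fit the formulas with m =
    0.\<close>
  define t where "t = (if ts = {#} then Tau else Node ts)"
  define K where "K = (real m + 1) * (real m + 2)"
  have "K \<noteq> 0" by (simp add: K_def add_eq_0_iff)
  define \<mu> where "\<mu> h = \<kappa> h / K" for h
  have t: "t \<in> T2" "t \<noteq> EmptyTree" "rho t = m + 2"
    using forest(1) by (auto simp: t_def m_def intro!: T2.intros)
  have psi'': "psi'' (c h) (A h) t k = K * (\<Prod>s\<in>#ts. psi (c h) (A h) s k)" for h k
    by (simp add: t_def m_def K_def algebra_simps)
  have "\<mu> \<in> O[at_right 0](\<lambda>_. 1)"
    using landau_o.big.mult_in_1[OF bigo_const forest(2), of "1 / K"]
    by (simp add: \<mu>_def[abs_def])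
  then have "forest_expansion c A (N + 2) (\<lambda>h x. \<mu> h * x ^ (\<Sum>t\<in>#{#t#}. rho t))
      (\<lambda>h j. \<mu> h * (h ^ (\<Sum>t\<in>#{#t#}. rho t) * (\<Prod>t\<in>#{#t#}. psi (c h) (A h) t j)))"
    using t by (intro forest_expansion.forest) auto
  moreover have "taylor_remainder (\<lambda>h x. \<kappa> h * x ^ m) = (\<lambda>h x. \<mu> h * x ^ (m + 2))"
    by (intro ext) (simp only: taylor_remainder_monomial \<mu>_def K_def)
  \<comment> \<open>The power of -h, taken with the minus sign in front of \<open>c\<close>, yields
    the sign \<open>(-1) ^ (rho t + 1)\<close>.\<close>
  moreover have "h\<^sup>2 * (\<Sum>k\<in>UNIV. A h $ j $ k * (\<kappa> h * (h ^ m * (\<Prod>t\<in>#ts. psi (c h) (A h) t k))))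
      - c h $ j * (\<mu> h * (- h) ^ (m + 2)) = \<mu> h * (h ^ (m + 2) * psi (c h) (A h) t j)" for h j
  proof -
    have \<kappa>: "\<kappa> h = \<mu> h * K"
      using \<open>K \<noteq> 0\<close> by (simp add: \<mu>_def)
    define S where "S = (\<Sum>k\<in>UNIV. A h $ j $ k * (\<Prod>t\<in>#ts. psi (c h) (A h) t k))"
    have 1: "(\<Sum>k\<in>UNIV. A h $ j $ k * (\<kappa> h * (h ^ m * (\<Prod>t\<in>#ts. psi (c h) (A h) t k)))) = \<mu> h * K * h ^ m * S"
      by (simp add: S_def \<kappa> sum_distrib_left mult_ac)
    have 2: "(\<Sum>k\<in>UNIV. A h $ j $ k * (K * (\<Prod>s\<in>#ts. psi (c h) (A h) s k))) = K * S"
      by (simp add: S_def sum_distrib_left mult_ac)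
    show ?thesis
      unfolding psi_nonempty[OF t(2)] psi'' t(3) 1 2
      by (simp add: power_minus[of h] power_add power2_eq_square algebra_simps)
  qed
  ultimately show ?case
    by (simp add: t(3) flip: m_def)
next
  case (remainder r R)
  note bound = uniform_bound_taylor_remainder[OF remainder(1)]
  have "(\<lambda>h. taylor_remainder r h (- h)) \<in> O[at_right 0](\<lambda>h. h ^ (N + 2))"
    by (rule uniform_bound_at[OF bound eventually_mono[OF eventually_at_right_less]]) simp
  from landau_o.big.mult[OF Bfun_vec_nth_bigo[OF bounded_c] this]
  have 1: "(\<lambda>h. c h $ j * taylor_remainder r h (- h)) \<in> O[at_right 0](\<lambda>h. h ^ (N + 2))" for j
    by simp
  have "(\<lambda>h. A h $ j $ k * R h k) \<in> O[at_right 0](\<lambda>h. h ^ N)" for j k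
    using landau_o.big.mult[OF Bfun_matrix_nth_bigo[OF bounded_A] remainder(2)] by simp
  then have "(\<lambda>h. \<Sum>k\<in>UNIV. A h $ j $ k * R h k) \<in> O[at_right 0](\<lambda>h. h ^ N)" for j
    by (intro big_sum_in_bigo)
  then have 2: "(\<lambda>h. h\<^sup>2 * (\<Sum>k\<in>UNIV. A h $ j $ k * R h k)) \<in> O[at_right 0](\<lambda>h. h ^ (N + 2))" for j
    unfolding add.commute[of N] power_add by (intro landau_o.big.mult_left)
  show ?case
    using sum_in_bigo(2)[OF 2 1] by (intro forest_expansion.remainder[OF bound])
next
  case (sum u U v V)
  have cont: "\<forall>\<^sub>F h in at_right 0. continuous_on {-h..h} (u h)" "\<forall>\<^sub>F h in at_right 0. continuous_on {-h..h} (v h)"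
    using forest_expansion_bounded(1) sum.hyps uniform_bound_continuous by blast+
  have add: "\<forall>\<^sub>F h in at_right 0. \<forall>x\<in>{-h..h}. taylor_remainder (\<lambda>h x. u h x + v h x) h x
      = taylor_remainder u h x + taylor_remainder v h x"
    using cont by eventually_elim (intro ballI taylor_remainder_add, auto)
  show ?case
  proof (rule forest_expansion_cong[OF forest_expansion.sum[OF sum.IH] add])
    fix j
    show "\<forall>\<^sub>F h in at_right 0. h\<^sup>2 * (\<Sum>k\<in>UNIV. A h $ j $ k * (U h k + V h k))
        - c h $ j * taylor_remainder (\<lambda>h x. u h x + v h x) h (- h)
      = h\<^sup>2 * (\<Sum>k\<in>UNIV. A h $ j $ k * U h k) - c h $ j * taylor_remainder u h (- h)
        + (h\<^sup>2 * (\<Sum>k\<in>UNIV. A h $ j $ k * V h k) - c h $ j * taylor_remainder v h (- h))"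
      using add eventually_at_right_less[of "0::real"]
    proof eventually_elim
      case (elim h)
      then have "taylor_remainder (\<lambda>h x. u h x + v h x) h (- h) = taylor_remainder u h (- h) + taylor_remainder v h (- h)"
        by auto
      then show ?case by (simp add: distrib_left sum.distrib algebra_simps)
    qed
  qed
qed

end


section \<open>Taylor polynomials\<close>

text \<open>No degree is recorded: forest expansions are closed under sums and products, so any
  polynomial can be substituted into them whatever its degree.\<close>

inductive polynomial_fun :: "nat \<Rightarrow> ((nat \<Rightarrow> real) \<Rightarrow> real) \<Rightarrow> bool" for d where
  monomial: "polynomial_fun d (\<lambda>u. a * (\<Prod>l<d. u l ^ e l))"
| add: "polynomial_fun d P \<Longrightarrow> polynomial_fun d Q \<Longrightarrow> polynomial_fun d (\<lambda>u. P u + Q u)"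

lemma polynomial_fun_const: "polynomial_fun d (\<lambda>u. a)"
  using polynomial_fun.monomial[of d a "\<lambda>_. 0"] by simp

lemma polynomial_fun_cmult: "polynomial_fun d P \<Longrightarrow> polynomial_fun d (\<lambda>u. b * P u)"
proof (induction rule: polynomial_fun.induct)
  case (monomial a e)
  show ?case using polynomial_fun.monomial[of d "b * a" e] by (simp add: mult.assoc)
next
  case (add P Q)
  show ?case using polynomial_fun.add[OF add.IH] by (simp add: distrib_left)
qed

lemma polynomial_fun_sum:
  fixes m :: nat
  shows "(\<And>i. i < m \<Longrightarrow> polynomial_fun d (P i)) \<Longrightarrow> polynomial_fun d (\<lambda>u. \<Sum>i<m. P i u)"
  by (induction m) (auto intro: polynomial_fun_const polynomial_fun.add)

lemma polynomial_fun_freeze: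
  "polynomial_fun d P \<Longrightarrow> polynomial_fun d (\<lambda>u. P (\<lambda>l. if l \<in> S then u l else a l))"
proof (induction rule: polynomial_fun.induct)
  case (monomial b e)
  have "b * (\<Prod>l<d. (if l \<in> S then u l else a l) ^ e l)
      = b * (\<Prod>l<d. if l \<in> S then 1 else a l ^ e l) * (\<Prod>l<d. u l ^ (if l \<in> S then e l else 0))" for u
    unfolding mult.assoc prod.distrib[symmetric]
    by (intro arg_cong[where f = "(*) b"] prod.cong) auto
  then show ?case
    by (simp only: polynomial_fun.monomial)
next
  case (add P Q)
  then show ?case by (intro polynomial_fun.add)
qed

lemma polynomial_fun_antiderivative:
  assumes "polynomial_fun d P" "i < d"
  shows "\<exists>Q. polynomial_fun d Q \<and>
    (\<forall>v s. ((\<lambda>s. Q (v(i := s))) has_real_derivative P (v(i := s))) (at s))"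
  using assms(1)
proof (induction rule: polynomial_fun.induct)
  case (monomial a e)
  define a' e' where "a' = a / real (e i + 1)" and "e' = e(i := e i + 1)"
  have split: "(\<Prod>l<d. (v(i := s)) l ^ f l) = s ^ f i * (\<Prod>l\<in>{..<d} - {i}. v l ^ f l)"
    for v and s :: real and f :: "nat \<Rightarrow> nat"
    using assms(2) by (subst prod.remove[of _ i]) (auto intro!: prod.cong)
  have "((\<lambda>s. a' * (\<Prod>l<d. (v(i := s)) l ^ e' l)) has_real_derivative
      a * (\<Prod>l<d. (v(i := s)) l ^ e l)) (at s)" for v s
  proof -
    define R where "R = (\<Prod>l\<in>{..<d} - {i}. v l ^ e l)"
    have R: "(\<Prod>l\<in>{..<d} - {i}. v l ^ e' l) = R"
      unfolding R_def e'_def by (intro prod.cong) auto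
    have "((\<lambda>s. a' * (s ^ (e i + 1) * R)) has_real_derivative
        a' * (real (e i + 1) * s ^ (e i + 1 - Suc 0) * R)) (at s)"
      by (rule DERIV_cmult[OF DERIV_cmult_right[OF DERIV_pow]])
    moreover have "a' * (real (e i + 1) * s ^ (e i + 1 - Suc 0) * R) = a * (s ^ e i * R)"
      by (simp add: a'_def add_eq_0_iff del: of_nat_Suc)
    moreover have "e' i = e i + 1" by (simp add: e'_def)
    ultimately show ?thesis
      unfolding split R R_def[symmetric] by (simp only:)
  qed
  then show ?case
    using polynomial_fun.monomial[of d a' e'] by (intro exI[of _ "\<lambda>u. a' * (\<Prod>l<d. u l ^ e' l)"]) blast
next
  case (add P P')
  then obtain Q Q' where "polynomial_fun d Q" "polynomial_fun d Q'"
    "\<And>v s. ((\<lambda>s. Q (v(i := s))) has_real_derivative P (v(i := s))) (at s)"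
    "\<And>v s. ((\<lambda>s. Q' (v(i := s))) has_real_derivative P' (v(i := s))) (at s)"
    by blast
  then show ?case
    by (intro exI[of _ "\<lambda>u. Q u + Q' u"] conjI allI polynomial_fun.add DERIV_add)
qed

lemma tendsto_coordinatewise:
  fixes f :: "'a \<Rightarrow> nat \<Rightarrow> real"
  assumes "\<And>i. ((\<lambda>x. f x i) \<longlongrightarrow> a i) F"
  shows "(f \<longlongrightarrow> a) F"
proof -
  have "limitin (product_topology (\<lambda>_. euclidean) UNIV) f a F"
    using assms unfolding limitin_componentwise by simp
  then show ?thesis
    by (simp add: euclidean_product_topology)
qed

text \<open>Boxes constrain finitely many coordinates, whereas continuity refers to the product
  topology of all of them. A counterexample for each radius 1/(n+1) gives a sequence converging to
  \<open>a\<close> in every coordinate, trivially so from d on, where both sides vanish.\<close>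

lemma continuous_on_Rd_bounded_near:
  fixes F :: "(nat \<Rightarrow> real) \<Rightarrow> real"
  assumes "continuous_on (Rd d) F" "a \<in> Rd d"
  shows "\<forall>\<^sub>F r in at_right 0. \<forall>u\<in>Rd d. (\<forall>i<d. \<bar>u i - a i\<bar> \<le> r) \<longrightarrow> \<bar>F u - F a\<bar> \<le> 1"
proof (rule ccontr)
  assume neg: "\<not> ?thesis"
  have "\<exists>u\<in>Rd d. (\<forall>i<d. \<bar>u i - a i\<bar> \<le> inverse (real (Suc n))) \<and> \<bar>F u - F a\<bar> > 1" for n
  proof (rule ccontr)
    assume *: "\<not> (\<exists>u\<in>Rd d. (\<forall>i<d. \<bar>u i - a i\<bar> \<le> inverse (real (Suc n))) \<and> \<bar>F u - F a\<bar> > 1)"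
    have "\<forall>\<^sub>F r in at_right 0. r < inverse (real (Suc n))"
      by (rule eventually_at_right_real[THEN eventually_mono]) auto
    then have "\<forall>\<^sub>F r in at_right 0. \<forall>u\<in>Rd d. (\<forall>i<d. \<bar>u i - a i\<bar> \<le> r) \<longrightarrow> \<bar>F u - F a\<bar> \<le> 1"
    proof eventually_elim
      case (elim r)
      show ?case
      proof (intro ballI impI)
        fix u assume "u \<in> Rd d" "\<forall>i<d. \<bar>u i - a i\<bar> \<le> r"
        with elim have "\<forall>i<d. \<bar>u i - a i\<bar> \<le> inverse (real (Suc n))"
          by (meson less_imp_le order_trans)
        with * \<open>u \<in> Rd d\<close> have "\<not> \<bar>F u - F a\<bar> > 1" by blast
        then show "\<bar>F u - F a\<bar> \<le> 1" by simp
      qed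
    qed
    with neg show False ..
  qed
  then obtain u where u: "\<And>n. u n \<in> Rd d" "\<And>n i. i < d \<Longrightarrow> \<bar>u n i - a i\<bar> \<le> inverse (real (Suc n))"
    "\<And>n. \<bar>F (u n) - F a\<bar> > 1"
    by metis
  have "(\<lambda>n. u n i) \<longlonglongrightarrow> a i" for i
  proof (cases "i < d")
    case True
    have "(\<lambda>n. u n i - a i) \<longlonglongrightarrow> 0"
      by (rule Lim_null_comparison[OF _ LIMSEQ_inverse_real_of_nat]) (use u(2)[OF True] in simp)
    then show ?thesis by (simp add: LIM_zero_iff)
  next
    case False
    then have "u n i = a i" for n using u(1)[of n] assms(2) by (auto simp: Rd_def)
    then show ?thesis by simp
  qed
  then have "u \<longlonglongrightarrow> a" by (rule tendsto_coordinatewise)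
  then have "(\<lambda>n. F (u n)) \<longlonglongrightarrow> F a"
    by (rule continuous_on_tendsto_compose[OF assms(1)]) (use assms(2) u(1) in auto)
  then have "\<forall>\<^sub>F n in sequentially. dist (F (u n)) (F a) < 1"
    by (rule tendstoD) simp
  with u(3) show False
    by (auto simp: dist_real_def eventually_sequentially not_less dest: less_imp_le) (meson less_asym order_refl)
qed

text \<open>Telescoping along the coordinates from \<open>a\<close> to \<open>u\<close>: in each coordinate, an antiderivative of
  the approximation of the partial derivative is compared with \<open>F\<close> by the mean value theorem.\<close>

lemma Ck_polynomial_approx:
  assumes "Ck d k F" "a \<in> Rd d"
  shows "\<exists>P C. polynomial_fun d P \<and>
    (\<forall>\<^sub>F r in at_right 0. \<forall>u\<in>Rd d. (\<forall>i<d. \<bar>u i - a i\<bar> \<le> r) \<longrightarrow> \<bar>F u - P u\<bar> \<le> C * r ^ k)"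
  using assms(1)
proof (induction k arbitrary: F)
  case 0
  then show ?case
    using continuous_on_Rd_bounded_near[OF _ assms(2), of F]
    by (intro exI[of _ "\<lambda>_. F a"] exI[of _ 1]) (simp add: polynomial_fun_const)
next
  case (Suc k)
  \<comment> \<open>One predicate bundles everything about coordinate i, so that all four objects
    are chosen simultaneously as functions of i.\<close>
  define approx where "approx i F' P C Q \<longleftrightarrow>
      (\<forall>u\<in>Rd d. ((\<lambda>x. F (u(i := x))) has_real_derivative F' u) (at (u i))) \<and>
      (\<forall>\<^sub>F r in at_right 0. \<forall>u\<in>Rd d. (\<forall>i<d. \<bar>u i - a i\<bar> \<le> r) \<longrightarrow> \<bar>F' u - P u\<bar> \<le> C * r ^ k) \<and>
      polynomial_fun d Q \<and> (\<forall>v s. ((\<lambda>s. Q (v(i := s))) has_real_derivative P (v(i := s))) (at s))"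
    for i F' P C Q
  have "\<exists>F' P C Q. approx i F' P C Q" if i: "i < d" for i
  proof -
    obtain F' where F': "\<forall>u\<in>Rd d. ((\<lambda>x. F (u(i := x))) has_real_derivative F' u) (at (u i))" "Ck d k F'"
      using Suc.prems i by auto
    obtain P C where P: "polynomial_fun d P"
      "\<forall>\<^sub>F r in at_right 0. \<forall>u\<in>Rd d. (\<forall>i<d. \<bar>u i - a i\<bar> \<le> r) \<longrightarrow> \<bar>F' u - P u\<bar> \<le> C * r ^ k"
      using Suc.IH[OF F'(2)] by blast
    obtain Q where Q: "polynomial_fun d Q"
      "\<forall>v s. ((\<lambda>s. Q (v(i := s))) has_real_derivative P (v(i := s))) (at s)"
      using polynomial_fun_antiderivative[OF P(1) i] by blast
    have "approx i F' P C Q"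
      unfolding approx_def by (intro conjI F' P Q)
    then show ?thesis by blast
  qed
  then obtain F' P C Q where approx: "\<And>i. i < d \<Longrightarrow> approx i (F' i) (P i) (C i) (Q i)"
    by metis
  have F': "((\<lambda>x. F (u(i := x))) has_real_derivative F' i u) (at (u i))" if "i < d" "u \<in> Rd d" for i u
    using approx[OF that(1)] that(2) unfolding approx_def by simp
  have P: "\<forall>\<^sub>F r in at_right 0. \<forall>u\<in>Rd d. (\<forall>i<d. \<bar>u i - a i\<bar> \<le> r) \<longrightarrow> \<bar>F' i u - P i u\<bar> \<le> C i * r ^ k" if "i < d" for i
    using approx[OF that] unfolding approx_def by simp
  have Q: "polynomial_fun d (Q i)" "((\<lambda>s. Q i (v(i := s))) has_real_derivative P i (v(i := s))) (at s)"
    if "i < d" for i v s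
    using approx[OF that] unfolding approx_def by simp_all
  define v where "v m u = (\<lambda>l. if l \<in> {..<m} then u l else a l)" for m :: nat and u :: "nat \<Rightarrow> real"
  \<comment> \<open>The points \<open>v m u\<close> and \<open>v (Suc m) u\<close> differ in
    coordinate m only. Each increment of \<open>F\<close> between them is replaced by that of
    \<open>Q m\<close>, so \<open>F - T\<close> becomes a sum of increments of
    \<open>F - Q m\<close>, whose derivative in coordinate m is small.\<close>
  define T where "T u = F a + (\<Sum>m<d. Q m (v (Suc m) u) + (- 1) * Q m (v m u))" for u
  have "polynomial_fun d T"
    unfolding T_def v_def
    by (intro polynomial_fun.add polynomial_fun_const polynomial_fun_sum polynomial_fun_cmult
        polynomial_fun_freeze Q(1)) auto
  moreover have "\<forall>\<^sub>F r in at_right 0. \<forall>i\<in>{..<d}. \<forall>u\<in>Rd d. (\<forall>i<d. \<bar>u i - a i\<bar> \<le> r) \<longrightarrow> \<bar>F' i u - P i u\<bar> \<le> C i * r ^ k"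
    using P by (intro eventually_ball_finite) auto
  then have "\<forall>\<^sub>F r in at_right 0. \<forall>u\<in>Rd d. (\<forall>i<d. \<bar>u i - a i\<bar> \<le> r) \<longrightarrow> \<bar>F u - T u\<bar> \<le> (\<Sum>m<d. C m) * r ^ Suc k"
    using eventually_at_right_less[of "0::real"]
  proof eventually_elim
    case (elim r)
    show ?case
    proof (intro ballI impI)
      fix u assume u: "u \<in> Rd d" "\<forall>i<d. \<bar>u i - a i\<bar> \<le> r"
      define D where "D m w = F w - Q m w" for m w
      have step: "\<bar>D m (v (Suc m) u) - D m (v m u)\<bar> \<le> C m * r ^ Suc k" if m: "m < d" for m
      proof -
        define w where "w s = (v m u)(m := s)" for s
        have w: "v (Suc m) u = w (u m)" "v m u = w (a m)"
          by (auto simp: w_def v_def fun_eq_iff)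
        have Rd: "w s \<in> Rd d" for s
          using u(1) assms(2) m by (auto simp: w_def v_def Rd_def)
        have "norm (D m (w (u m)) - D m (w (a m))) \<le> (C m * r ^ k) * norm (u m - a m)"
        proof (rule field_differentiable_bound[where S = "closed_segment (a m) (u m)" and f = "\<lambda>s. D m (w s)"])
          fix s assume s: "s \<in> closed_segment (a m) (u m)"
          have "((\<lambda>x. F ((w s)(m := x))) has_real_derivative F' m (w s)) (at (w s m))"
            using F'[OF m Rd] .
          then have "((\<lambda>s. F (w s)) has_real_derivative F' m (w s)) (at s)"
            by (simp add: w_def)
          moreover have "((\<lambda>s. Q m (w s)) has_real_derivative P m (w s)) (at s)"
            using Q(2)[OF m, of "v m u" s] by (simp only: w_def)
          ultimately show "((\<lambda>s. D m (w s)) has_real_derivative F' m (w s) - P m (w s)) (at s within closed_segment (a m) (u m))"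
            unfolding D_def by (rule has_field_derivative_at_within[OF DERIV_diff])
          have "\<bar>s - a m\<bar> \<le> \<bar>u m - a m\<bar>"
            using s by (auto simp: closed_segment_eq_real_ivl split: if_splits)
          also have "\<dots> \<le> r" using u(2) m by blast
          finally have "\<bar>w s i - a i\<bar> \<le> r" if "i < d" for i
            using u(2) that elim by (simp add: w_def v_def)
          then have "\<forall>i<d. \<bar>w s i - a i\<bar> \<le> r" by blast
          then show "norm (F' m (w s) - P m (w s)) \<le> C m * r ^ k"
            using elim Rd m by auto
        qed auto
        also have "\<dots> \<le> (C m * r ^ k) * r"
        proof (rule mult_left_mono)
          show "norm (u m - a m) \<le> r" using u m by auto
          \<comment> \<open>No sign of \<open>C m\<close> is known beforehand; the bound at the
            centre \<open>a\<close>, which lies in every box, shows that it is nonnegative.\<close>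
          have "\<bar>F' m a - P m a\<bar> \<le> C m * r ^ k"
            using elim assms(2) m by auto
          then show "0 \<le> C m * r ^ k" by linarith
        qed
        finally show ?thesis by (simp add: w mult_ac)
      qed
      have "v d u = u" "v 0 u = a"
        using u(1) assms(2) by (auto simp: v_def Rd_def fun_eq_iff)
      then have "F u - F a = (\<Sum>m<d. F (v (Suc m) u) - F (v m u))"
        by (simp add: sum_lessThan_telescope[of "\<lambda>m. F (v m u)"])
      then have "F u - T u = (\<Sum>m<d. D m (v (Suc m) u) - D m (v m u))"
        by (simp add: T_def D_def sum.distrib sum_subtractf sum_negf algebra_simps)
      then have "\<bar>F u - T u\<bar> \<le> (\<Sum>m<d. \<bar>D m (v (Suc m) u) - D m (v m u)\<bar>)"
        by simp
      also have "\<dots> \<le> (\<Sum>m<d. C m * r ^ Suc k)"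
        using step by (intro sum_mono) auto
      finally show "\<bar>F u - T u\<bar> \<le> (\<Sum>m<d. C m) * r ^ Suc k"
        by (simp add: sum_distrib_right)
    qed
  qed
  ultimately show ?case by blast
qed

lemma filterlim_cmult_at_right_0:
  assumes "(K::real) > 0"
  shows "filterlim (\<lambda>h. K * h) (at_right 0) (at_right 0)"
proof -
  have "((\<lambda>h. K * h) \<longlongrightarrow> 0) (at_right 0)"
    by (auto intro!: tendsto_eq_intros)
  moreover have "\<forall>\<^sub>F h in at_right 0. K * h \<in> {0<..} \<and> K * h \<noteq> 0"
    using eventually_at_right_less[of "0::real"] by eventually_elim (use assms in auto)
  ultimately show ?thesis
    unfolding filterlim_at by simp
qed

lemma finite_common_linear_bound:
  fixes w :: "nat \<Rightarrow> real \<Rightarrow> 'x \<Rightarrow> real"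
  assumes "\<And>i. i < d \<Longrightarrow> \<exists>C. \<forall>\<^sub>F h in at_right 0. \<forall>x\<in>X h. \<bar>w i h x\<bar> \<le> C * h"
  obtains K where "K > 0" "\<forall>\<^sub>F h in at_right 0. \<forall>x\<in>X h. \<forall>i<d. \<bar>w i h x\<bar> \<le> K * h"
proof -
  have "\<forall>i. \<exists>C. i < d \<longrightarrow> (\<forall>\<^sub>F h in at_right 0. \<forall>x\<in>X h. \<bar>w i h x\<bar> \<le> C * h)"
    using assms by blast
  from choice[OF this] obtain C where
    C: "\<And>i. i < d \<Longrightarrow> \<forall>\<^sub>F h in at_right 0. \<forall>x\<in>X h. \<bar>w i h x\<bar> \<le> C i * h"
    by auto
  \<comment> \<open>The summand 1 makes \<open>K\<close> positive even when d = 0, as the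
    substitution r = K h requires.\<close>
  define K where "K = 1 + (\<Sum>i<d. \<bar>C i\<bar>)"
  have "K > 0" by (simp add: K_def add_pos_nonneg sum_nonneg)
  have K: "C i \<le> K" if "i < d" for i
  proof -
    have "\<bar>C i\<bar> \<le> (\<Sum>i<d. \<bar>C i\<bar>)" using that by (intro member_le_sum) auto
    then show ?thesis by (simp add: K_def)
  qed
  have "\<forall>\<^sub>F h in at_right 0. \<forall>i\<in>{..<d}. \<forall>x\<in>X h. \<bar>w i h x\<bar> \<le> C i * h"
    using C by (intro eventually_ball_finite) auto
  with eventually_at_right_less[of "0::real"]
  have "\<forall>\<^sub>F h in at_right 0. \<forall>x\<in>X h. \<forall>i<d. \<bar>w i h x\<bar> \<le> K * h"
  proof eventually_elim
    case (elim h)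
    then have "C i * h \<le> K * h" if "i < d" for i
      using K[OF that] by (intro mult_right_mono) auto
    with elim show ?case by (meson lessThan_iff order_trans)
  qed
  with \<open>K > 0\<close> show thesis by (rule that)
qed

text \<open>\<open>F\<close> is split into an approximating polynomial and a rest. The polynomial
  part is covered by the closure under products; the rest is O((K h)^N) on both sides, because the
  solution and the stages stay within K h of the same point \<open>a\<close>.\<close>

lemma forest_expansion_compose:
  fixes c :: "real \<Rightarrow> real ^ 's" and A :: "real \<Rightarrow> real ^ 's ^ 's"
  assumes bounded: "Bfun c (at_right 0)" "Bfun A (at_right 0)"
    and Ck: "Ck d N F" and a: "a \<in> Rd d"
    and y_Rd: "\<forall>\<^sub>F h in at_right 0. \<forall>x\<in>{-h..h}. y h x \<in> Rd d"
    and Y_Rd: "\<And>j. \<forall>\<^sub>F h in at_right 0. Y h j \<in> Rd d"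
    and exp: "\<And>i. i < d \<Longrightarrow> forest_expansion c A N (\<lambda>h x. y h x i) (\<lambda>h j. Y h j i)"
    and y_near: "\<And>i. i < d \<Longrightarrow> uniform_bound 1 (\<lambda>h x. y h x i - a i)"
    and Y_near: "\<And>i j. i < d \<Longrightarrow> (\<lambda>h. Y h j i - a i) \<in> O[at_right 0](\<lambda>h. h)"
  shows "forest_expansion c A N (\<lambda>h x. F (y h x)) (\<lambda>h j. F (Y h j))"
proof -
  obtain P C where poly: "polynomial_fun d P" and
    C: "\<forall>\<^sub>F r in at_right 0. \<forall>u\<in>Rd d. (\<forall>i<d. \<bar>u i - a i\<bar> \<le> r) \<longrightarrow> \<bar>F u - P u\<bar> \<le> C * r ^ N"
    using Ck_polynomial_approx[OF Ck a] by blast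
  have P: "forest_expansion c A N (\<lambda>h x. P (y h x)) (\<lambda>h j. P (Y h j))"
    using poly
  proof induction
    case (monomial b e)
    show ?case
      by (intro forest_expansion_mult[OF bounded] forest_expansion_const bigo_const
          forest_expansion_prod[OF bounded] forest_expansion_power[OF bounded] exp)
  next
    case (add P Q)
    show ?case by (rule forest_expansion.sum[OF add.IH])
  qed
  have approx: "\<forall>\<^sub>F h in at_right 0. \<forall>u\<in>Rd d. (\<forall>i<d. \<bar>u i - a i\<bar> \<le> K * h) \<longrightarrow> \<bar>F u - P u\<bar> \<le> C * K ^ N * h ^ N"
    if "K > 0" for K
    using eventually_compose_filterlim[OF C filterlim_cmult_at_right_0[OF that]]
    by (simp add: power_mult_distrib mult.assoc)
  have "uniform_bound N (\<lambda>h x. F (y h x) - P (y h x))"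
  proof -
    obtain K where K: "K > 0" "\<forall>\<^sub>F h in at_right 0. \<forall>x\<in>{-h..h}. \<forall>i<d. \<bar>y h x i - a i\<bar> \<le> K * h"
    proof (rule finite_common_linear_bound[where X = "\<lambda>h. {-h..h}" and w = "\<lambda>i h x. y h x i - a i" and d = d])
      fix i assume "i < d"
      then obtain B where "\<forall>\<^sub>F h in at_right 0. continuous_on {-h..h} (\<lambda>x. y h x i - a i) \<and>
          (\<forall>x\<in>{-h..h}. \<bar>y h x i - a i\<bar> \<le> B * h ^ 1)"
        using y_near unfolding uniform_bound_def by blast
      then have "\<forall>\<^sub>F h in at_right 0. \<forall>x\<in>{-h..h}. \<bar>y h x i - a i\<bar> \<le> B * h"
        by eventually_elim simp
      then show "\<exists>C. \<forall>\<^sub>F h in at_right 0. \<forall>x\<in>{-h..h}. \<bar>y h x i - a i\<bar> \<le> C * h" ..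
    qed
    have cont_y: "\<forall>\<^sub>F h in at_right 0. \<forall>i\<in>{..<d}. continuous_on {-h..h} (\<lambda>x. y h x i)"
      using exp forest_expansion_bounded(1)[OF bounded] uniform_bound_continuous
      by (intro eventually_ball_finite) blast+
    have "\<forall>\<^sub>F h in at_right 0. continuous_on {-h..h} (\<lambda>x. F (y h x) - P (y h x)) \<and>
        (\<forall>x\<in>{-h..h}. \<bar>F (y h x) - P (y h x)\<bar> \<le> (C * K ^ N) * h ^ N)"
      using K(2) approx[OF K(1)] y_Rd cont_y uniform_bound_continuous[OF forest_expansion_bounded(1)[OF bounded P]]
    proof eventually_elim
      case (elim h)
      have "continuous_on {-h..h} (y h)"
      proof (rule continuous_on_coordinatewise_then_product)
        fix i
        show "continuous_on {-h..h} (\<lambda>x. y h x i)"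
        proof (cases "i < d")
          case True
          then show ?thesis using elim by simp
        next
          case False
          have "continuous_on {-h..h} (\<lambda>x. y h x i) \<longleftrightarrow> continuous_on {-h..h} (\<lambda>x. 0 :: real)"
            using elim False by (intro continuous_on_cong) (auto simp: Rd_def)
          then show ?thesis by simp
        qed
      qed
      then have "continuous_on {-h..h} (\<lambda>x. F (y h x))"
        using elim by (intro continuous_on_compose2[OF Ck_continuous_on[OF Ck]]) auto
      with elim show ?case by (auto intro!: continuous_on_diff)
    qed
    then show ?thesis unfolding uniform_bound_def by blast
  qed
  moreover have "(\<lambda>h. F (Y h j) - P (Y h j)) \<in> O[at_right 0](\<lambda>h. h ^ N)" for j
  proof -
    \<comment> \<open>Stage values have no x, so the uniform bound is taken over a one-point
      set.\<close>
    obtain K where K: "K > 0" "\<forall>\<^sub>F h in at_right 0. \<forall>x\<in>{()}. \<forall>i<d. \<bar>Y h j i - a i\<bar> \<le> K * h"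
    proof (rule finite_common_linear_bound[where X = "\<lambda>h. {()}" and w = "\<lambda>i h x. Y h j i - a i" and d = d])
      fix i assume "i < d"
      from Y_near[OF this] obtain B where "\<forall>\<^sub>F h in at_right 0. norm (Y h j i - a i) \<le> B * norm h"
        by (rule landau_o.bigE)
      with eventually_at_right_less[of "0::real"]
      have "\<forall>\<^sub>F h in at_right 0. \<forall>x\<in>{()}. \<bar>Y h j i - a i\<bar> \<le> B * h"
        by eventually_elim simp
      then show "\<exists>C. \<forall>\<^sub>F h in at_right 0. \<forall>x\<in>{()}. \<bar>Y h j i - a i\<bar> \<le> C * h" ..
    qed
    have "\<forall>\<^sub>F h in at_right 0. norm (F (Y h j) - P (Y h j)) \<le> (C * K ^ N) * norm (h ^ N)"
      using K(2) approx[OF K(1)] Y_Rd[of j] eventually_at_right_less[of "0::real"]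
      by eventually_elim simp
    then show ?thesis by (rule bigoI)
  qed
  ultimately have "forest_expansion c A N (\<lambda>h x. F (y h x) - P (y h x)) (\<lambda>h j. F (Y h j) - P (Y h j))"
    by (rule forest_expansion.remainder)
  from forest_expansion.sum[OF this P] show ?thesis by simp
qed


section \<open>The defect and variation of constants\<close>

text \<open>The functional L of the overview: \<open>u h (h * z)\<close> belongs to the step from
  x_n to x_n + h and \<open>u h (- h * z)\<close> to the step back to x_n - h. The common factor
  \<open>h\<^sup>2\<close> is left outside.\<close>

definition oscillator_integral :: "real \<Rightarrow> (real \<Rightarrow> real \<Rightarrow> real) \<Rightarrow> real \<Rightarrow> real" where
  "oscillator_integral \<omega> u h =
     integral {0..1} (\<lambda>z. sin (\<omega> * h * (1 - z)) / (\<omega> * h) * (u h (h * z) + u h (- h * z)))"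

lemma oscillator_integral_integrable:
  fixes \<omega> h :: real
  assumes "\<omega> > 0" "h > 0" "continuous_on {-h..h} (u h)"
  shows "continuous_on {0..1} (\<lambda>z. sin (\<omega> * h * (1 - z)) / (\<omega> * h) * (u h (h * z) + u h (- h * z)))"
  using assms by (intro continuous_intros continuous_on_scaled[OF assms(3)]) auto

lemma oscillator_integral_monomial:
  "oscillator_integral \<omega> (\<lambda>h x. \<kappa> h * x ^ m) h
     = \<kappa> h * h ^ m * (1 + (-1) ^ m) * fact m * phi (Suc (Suc m)) (\<omega> * h)"
proof -
  have "sin (\<omega> * h * (1 - z)) / (\<omega> * h) * (\<kappa> h * (h * z) ^ m + \<kappa> h * (- h * z) ^ m)
      = (\<kappa> h * h ^ m * (1 + (-1) ^ m) * fact m) * (sin (\<omega> * h * (1 - z)) / (\<omega> * h) * (z ^ m / fact m))" for z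
  proof -
    have *: "(- h * z) ^ m = (-1) ^ m * (h ^ m * z ^ m)" "(h * z) ^ m = h ^ m * z ^ m"
      by (metis mult_minus_left power_minus power_mult_distrib) (rule power_mult_distrib)
    show ?thesis unfolding * by (simp add: algebra_simps)
  qed
  then show ?thesis
    unfolding oscillator_integral_def by (simp only: integral_mult_right phi.simps)
qed

lemma oscillator_integral_bigo:
  assumes "\<omega> > 0" "uniform_bound N u"
  shows "oscillator_integral \<omega> u \<in> O[at_right 0](\<lambda>h. h ^ N)"
proof -
  obtain C where C: "\<forall>\<^sub>F h in at_right 0. continuous_on {-h..h} (u h) \<and> (\<forall>x\<in>{-h..h}. \<bar>u h x\<bar> \<le> C * h ^ N)"
    using assms(2) unfolding uniform_bound_def by blast
  have "\<forall>\<^sub>F h in at_right 0. norm (oscillator_integral \<omega> u h) \<le> (2 * C) * norm (h ^ N)"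
    using C eventually_at_right_less[of "0::real"]
  proof eventually_elim
    case (elim h)
    have "norm (oscillator_integral \<omega> u h) \<le> (2 * (C * h ^ N)) * (1 - 0)"
      unfolding oscillator_integral_def
    proof (rule integral_bound)
      fix z :: real assume z: "z \<in> {0..1}"
      have "h * z \<le> h * 1" "0 \<le> h * z" using z elim by (auto intro!: mult_left_mono)
      then have "h * z \<in> {-h..h}" "- h * z \<in> {-h..h}" using elim by auto
      then have "\<bar>u h (h * z)\<bar> \<le> C * h ^ N" "\<bar>u h (- h * z)\<bar> \<le> C * h ^ N"
        using elim by blast+
      then have "\<bar>u h (h * z) + u h (- h * z)\<bar> \<le> 2 * (C * h ^ N)" by linarith
      moreover have "\<bar>sin (\<omega> * h * (1 - z)) / (\<omega> * h)\<bar> \<le> 1"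
        using sin_quotient_bound[of "\<omega> * h" z] assms(1) elim z by simp
      ultimately have "\<bar>sin (\<omega> * h * (1 - z)) / (\<omega> * h)\<bar> * \<bar>u h (h * z) + u h (- h * z)\<bar> \<le> 1 * (2 * (C * h ^ N))"
        by (intro mult_mono) auto
      then show "norm (sin (\<omega> * h * (1 - z)) / (\<omega> * h) * (u h (h * z) + u h (- h * z))) \<le> 2 * (C * h ^ N)"
        unfolding real_norm_def abs_mult by simp
    next
      show "continuous_on {0..1} (\<lambda>z. sin (\<omega> * h * (1 - z)) / (\<omega> * h) * (u h (h * z) + u h (- h * z)))"
        using elim assms(1) by (intro oscillator_integral_integrable) auto
    qed simp
    then show ?case using elim by simp
  qed
  then show ?thesis by (rule bigoI)
qed

text \<open>On a forest of total order m, with root added to give the tree t, the defect is -h^m /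
  ((m + 1)(m + 2)) times the defect in the order condition of t, up to \<open>\<kappa> h\<close>.
  The exponents m and q + 1 - (m + 2) add up to q - 1.\<close>

lemma forest_expansion_defect:
  fixes c b :: "real \<Rightarrow> real ^ 's" and A :: "real \<Rightarrow> real ^ 's ^ 's"
  assumes bounded: "Bfun c (at_right 0)" "Bfun A (at_right 0)" "Bfun b (at_right 0)"
    and \<omega>: "\<omega> > 0" and N: "q \<le> N + 1"
    and order: "\<And>t. t \<in> T2 \<Longrightarrow> t \<noteq> EmptyTree \<Longrightarrow> rho t \<le> q \<Longrightarrow>
      (\<lambda>h. b h \<bullet> psi''_vec (c h) (A h) t - (1 + (-1) ^ rho t) * fact (rho t) * phi (rho t) (\<omega> * h))
        \<in> O[at_right 0](\<lambda>h. h ^ (q + 1 - rho t))"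
    and exp: "forest_expansion c A N u U"
  shows "(\<lambda>h. oscillator_integral \<omega> u h - (\<Sum>j\<in>UNIV. b h $ j * U h j)) \<in> O[at_right 0](\<lambda>h. h ^ (q - 1))"
  using exp
proof induction
  case (forest ts \<kappa>)
  define m where "m = (\<Sum>t\<in>#ts. rho t)"
  define t where "t = (if ts = {#} then Tau else Node ts)"
  define K where "K = (real m + 1) * (real m + 2)"
  have K: "K \<noteq> 0" by (simp add: K_def add_eq_0_iff)
  have t: "t \<in> T2" "t \<noteq> EmptyTree" "rho t = Suc (Suc m)"
    using forest(1) by (auto simp: t_def m_def intro!: T2.intros)
  have psi'': "psi'' (c h) (A h) t k = K * (\<Prod>s\<in>#ts. psi (c h) (A h) s k)" for h k
    by (simp add: t_def m_def K_def algebra_simps)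
  define B where "B h = (1 + (-1) ^ m) * fact m * phi (Suc (Suc m)) (\<omega> * h)
    - (\<Sum>j\<in>UNIV. b h $ j * (\<Prod>s\<in>#ts. psi (c h) (A h) s j))" for h
  have "(\<lambda>h. h ^ m * B h) \<in> O[at_right 0](\<lambda>h. h ^ (q - 1))"
  proof (cases "m + 2 \<le> q")
    case True
    have "b h \<bullet> psi''_vec (c h) (A h) t - (1 + (-1) ^ rho t) * fact (rho t) * phi (rho t) (\<omega> * h) = (- K) * B h" for h
    proof -
      have "b h \<bullet> psi''_vec (c h) (A h) t = K * (\<Sum>j\<in>UNIV. b h $ j * (\<Prod>s\<in>#ts. psi (c h) (A h) s j))"
        by (simp add: psi''_vec_def inner_vec_def psi'' sum_distrib_left mult_ac)
      moreover have "fact (rho t) = K * fact m"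
        by (simp add: t(3) K_def algebra_simps)
      ultimately show ?thesis
        by (simp only: B_def t(3)) (simp add: algebra_simps del: phi.simps)
    qed
    then have "(\<lambda>h. (- K) * B h) \<in> O[at_right 0](\<lambda>h. h ^ (q + 1 - rho t))"
      using order[OF t(1,2)] True t(3) by simp
    then have "B \<in> O[at_right 0](\<lambda>h. h ^ (q + 1 - rho t))"
      by (subst (asm) cmult_in_bigo_iff) (use K in simp)
    then have "(\<lambda>h. h ^ m * B h) \<in> O[at_right 0](\<lambda>h. h ^ m * h ^ (q + 1 - rho t))"
      by (rule landau_o.big.mult_left)
    moreover have "m + (q + 1 - rho t) = q - 1" using True t(3) by simp
    ultimately show ?thesis by (simp only: flip: power_add)
  next
    \<comment> \<open>Now m is at least q - 1, so \<open>h ^ m\<close> alone is small enough and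
      \<open>B\<close> need only be bounded.\<close>
    case False
    have "(\<lambda>h. phi (Suc (Suc m)) (\<omega> * h)) \<in> O[at_right 0](\<lambda>_. 1)"
      using landau_o.big.compose[OF phi_Suc_Suc_bigo filterlim_cmult_at_right_0[OF \<omega>]] .
    then have "B \<in> O[at_right 0](\<lambda>_. 1)"
      unfolding B_def
      by (intro sum_in_bigo big_sum_in_bigo landau_o.big.mult_in_1 bigo_const prod_mset_bigo_1
          Bfun_vec_nth_bigo psi_bigo_1 bounded)
    then have "(\<lambda>h. h ^ m * B h) \<in> O[at_right 0](\<lambda>h. h ^ (q - 1) * 1)"
      using False power_bigo_at_right_0[of "q - 1" m] by (intro landau_o.big.mult) auto
    then show ?thesis by simp
  qed
  from landau_o.big.mult[OF forest(2) this]
  have "(\<lambda>h. \<kappa> h * (h ^ m * B h)) \<in> O[at_right 0](\<lambda>h. h ^ (q - 1))" by simp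
  moreover have "\<kappa> h * h ^ m * (1 + (-1) ^ m) * fact m * phi (Suc (Suc m)) (\<omega> * h)
      - (\<Sum>j\<in>UNIV. b h $ j * (\<kappa> h * (h ^ m * (\<Prod>t\<in>#ts. psi (c h) (A h) t j)))) = \<kappa> h * (h ^ m * B h)" for h
  proof -
    have "(\<Sum>j\<in>UNIV. b h $ j * (\<kappa> h * (h ^ m * (\<Prod>t\<in>#ts. psi (c h) (A h) t j))))
        = \<kappa> h * h ^ m * (\<Sum>j\<in>UNIV. b h $ j * (\<Prod>t\<in>#ts. psi (c h) (A h) t j))"
      by (simp add: sum_distrib_left mult_ac)
    then show ?thesis
      by (simp only: B_def) (simp add: algebra_simps del: phi.simps)
  qed
  ultimately show ?case
    by (simp only: oscillator_integral_monomial flip: m_def)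
next
  case (remainder r R)
  have "(\<lambda>h. b h $ j * R h j) \<in> O[at_right 0](\<lambda>h. h ^ N)" for j
    using landau_o.big.mult[OF Bfun_vec_nth_bigo[OF bounded(3)] remainder(2)] by simp
  then have "(\<lambda>h. oscillator_integral \<omega> r h - (\<Sum>j\<in>UNIV. b h $ j * R h j)) \<in> O[at_right 0](\<lambda>h. h ^ N)"
    by (intro sum_in_bigo(2) big_sum_in_bigo oscillator_integral_bigo[OF \<omega> remainder(1)])
  also have "(\<lambda>h::real. h ^ N) \<in> O[at_right 0](\<lambda>h. h ^ (q - 1))"
    using N by (intro power_bigo_at_right_0) simp
  finally show ?case .
next
  case (sum u U v V)
  have cont: "\<forall>\<^sub>F h in at_right 0. continuous_on {-h..h} (u h)" "\<forall>\<^sub>F h in at_right 0. continuous_on {-h..h} (v h)"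
    using forest_expansion_bounded(1)[OF bounded(1,2)] sum.hyps uniform_bound_continuous by blast+
  have "\<forall>\<^sub>F h in at_right 0. oscillator_integral \<omega> u h - (\<Sum>j\<in>UNIV. b h $ j * U h j)
        + (oscillator_integral \<omega> v h - (\<Sum>j\<in>UNIV. b h $ j * V h j))
      = oscillator_integral \<omega> (\<lambda>h x. u h x + v h x) h - (\<Sum>j\<in>UNIV. b h $ j * (U h j + V h j))"
    using cont eventually_at_right_less[of "0::real"]
  proof eventually_elim
    case (elim h)
    define k where "k z = sin (\<omega> * h * (1 - z)) / (\<omega> * h)" for z
    have "(\<lambda>z. k z * (w (h * z) + w (- h * z))) integrable_on {0..1}"
      if "continuous_on {-h..h} w" for w
      unfolding k_def using oscillator_integral_integrable[OF \<omega>, of h "\<lambda>h. w"] elim that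
      by (intro integrable_continuous_real) auto
    then have "integral {0..1} (\<lambda>z. k z * (u h (h * z) + u h (- h * z)) + k z * (v h (h * z) + v h (- h * z)))
       = oscillator_integral \<omega> u h + oscillator_integral \<omega> v h"
      unfolding oscillator_integral_def k_def[symmetric] using elim by (intro integral_add) auto
    moreover have "oscillator_integral \<omega> (\<lambda>h x. u h x + v h x) h
      = integral {0..1} (\<lambda>z. k z * (u h (h * z) + u h (- h * z)) + k z * (v h (h * z) + v h (- h * z)))"
      unfolding oscillator_integral_def k_def[symmetric]
      by (intro arg_cong[where f = "integral {0..1}"]) (simp add: fun_eq_iff algebra_simps)
    ultimately show ?case by (simp add: distrib_left sum.distrib)
  qed
  with sum_in_bigo(1)[OF sum.IH] show ?case
    by (subst (asm) landau_o.big.in_cong)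
qed

section \<open>Integral formulas along the exact solution\<close>

lemma affine_path_derivative:
  fixes w :: "real \<Rightarrow> real"
  assumes "\<And>t. t \<in> closed_segment a (a + x) \<Longrightarrow> (w has_real_derivative w' t) (at t)" "z \<in> {0..1}"
  shows "((\<lambda>z. w (a + x * z)) has_real_derivative x * w' (a + x * z)) (at z within {0..1})"
proof -
  have 1: "a + x * z \<in> closed_segment a (a + x)"
    using assms(2) by (auto simp: in_segment algebra_simps intro!: exI[of _ z])
  have 2: "((\<lambda>z. a + x * z) has_real_derivative x) (at z within {0..1})"
    by (auto intro!: derivative_eq_intros)
  show ?thesis
    by (rule DERIV_cong[OF DERIV_chain2[OF assms(1)[OF 1] 2] mult.commute])
qed

text \<open>The function \<open>W\<close> moves from the first-order Taylor polynomial at z = 0 to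
  \<open>w (a + x)\<close> at z = 1, and its derivative is the integrand. Steps of either sign
  occur, hence the closed segment.\<close>

lemma taylor_second_order:
  fixes w w' w'' :: "real \<Rightarrow> real"
  assumes w: "\<And>t. t \<in> closed_segment a (a + x) \<Longrightarrow> (w has_real_derivative w' t) (at t)"
    and w': "\<And>t. t \<in> closed_segment a (a + x) \<Longrightarrow> (w' has_real_derivative w'' t) (at t)"
  shows "w (a + x) = w a + x * w' a + x\<^sup>2 * integral {0..1} (\<lambda>z. (1 - z) * w'' (a + x * z))"
proof -
  define W where "W z = w (a + x * z) + x * ((1 - z) * w' (a + x * z))" for z
  have "((\<lambda>z. x\<^sup>2 * ((1 - z) * w'' (a + x * z))) has_integral W 1 - W 0) {0..1}"
  proof (rule fundamental_theorem_of_calculus)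
    fix z :: real assume z: "z \<in> {0..1}"
    have "((\<lambda>z. 1 - z) has_real_derivative -1) (at z within {0..1})"
      by (auto intro!: derivative_eq_intros)
    from DERIV_add[OF affine_path_derivative[OF w z] DERIV_cmult[OF DERIV_mult[OF this affine_path_derivative[OF w' z]]]]
    have "(W has_real_derivative x\<^sup>2 * ((1 - z) * w'' (a + x * z))) (at z within {0..1})"
      unfolding W_def by (rule DERIV_cong) (auto simp: power2_eq_square algebra_simps)
    then show "(W has_vector_derivative x\<^sup>2 * ((1 - z) * w'' (a + x * z))) (at z within {0..1})"
      by (simp only: has_real_derivative_iff_has_vector_derivative)
  qed simp
  then have "x\<^sup>2 * integral {0..1} (\<lambda>z. (1 - z) * w'' (a + x * z)) = W 1 - W 0"
    unfolding integral_mult_right[symmetric] by (rule integral_unique)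
  then show ?thesis by (simp add: W_def)
qed

text \<open>The frequency \<nu> is tied to the step only through its square, so that one kernel with
  \<nu> = \<omega> h serves both x = h and x = -h.\<close>

lemma variation_of_constants:
  fixes w w' \<gamma> :: "real \<Rightarrow> real"
  assumes w: "\<And>t. t \<in> closed_segment a (a + x) \<Longrightarrow> (w has_real_derivative w' t) (at t)"
    and w': "\<And>t. t \<in> closed_segment a (a + x) \<Longrightarrow> (w' has_real_derivative - \<omega>\<^sup>2 * w t + \<gamma> t) (at t)"
    and \<nu>: "\<nu> \<noteq> 0" "\<nu>\<^sup>2 = \<omega>\<^sup>2 * x\<^sup>2"
  shows "((\<lambda>z. x\<^sup>2 * (sin (\<nu> * (1 - z)) / \<nu> * \<gamma> (a + x * z))) has_integral
    w (a + x) - cos \<nu> * w a - x * (sin \<nu> / \<nu>) * w' a) {0..1}"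
proof -
  \<comment> \<open>The value at the endpoint that the unperturbed oscillator would reach if started
    from the solution at \<open>a + x * z\<close>; for vanishing \<open>\<gamma>\<close> it is
    constant in z.\<close>
  define W where "W z = cos (\<nu> * (1 - z)) * w (a + x * z) + x * (sin (\<nu> * (1 - z)) / \<nu> * w' (a + x * z))" for z
  have "((\<lambda>z. x\<^sup>2 * (sin (\<nu> * (1 - z)) / \<nu> * \<gamma> (a + x * z))) has_integral W 1 - W 0) {0..1}"
  proof (rule fundamental_theorem_of_calculus)
    fix z :: real assume z: "z \<in> {0..1}"
    define S C where "S = sin (\<nu> * (1 - z))" and "C = cos (\<nu> * (1 - z))"
    have cos: "((\<lambda>z. cos (\<nu> * (1 - z))) has_real_derivative \<nu> * S) (at z within {0..1})"
      unfolding S_def by (auto intro!: derivative_eq_intros)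
    have sin: "((\<lambda>z. sin (\<nu> * (1 - z)) / \<nu>) has_real_derivative - C) (at z within {0..1})"
      unfolding C_def using \<nu>(1) by (auto intro!: derivative_eq_intros)
    have path: "((\<lambda>z. w (a + x * z)) has_real_derivative x * w' (a + x * z)) (at z within {0..1})"
      "((\<lambda>z. w' (a + x * z)) has_real_derivative x * (- \<omega>\<^sup>2 * w (a + x * z) + \<gamma> (a + x * z))) (at z within {0..1})"
      by (rule affine_path_derivative[OF w z], assumption) (rule affine_path_derivative[OF w' z])
    \<comment> \<open>The relation between \<nu> and \<omega> enters here: the oscillator term in
      w'' cancels the derivative of the cosine.\<close>
    have "x\<^sup>2 * (S / \<nu> * (\<omega>\<^sup>2 * w (a + x * z))) = (\<omega>\<^sup>2 * x\<^sup>2) / \<nu> * S * w (a + x * z)"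
      by simp
    also have "\<dots> = \<nu> * S * w (a + x * z)"
      unfolding \<nu>(2)[symmetric] using \<nu>(1) by (simp add: power2_eq_square)
    finally have S: "x\<^sup>2 * (S / \<nu> * (\<omega>\<^sup>2 * w (a + x * z))) = \<nu> * S * w (a + x * z)" .
    have "\<nu> * S * w (a + x * z) + x * w' (a + x * z) * C
        + x * (- C * w' (a + x * z) + x * (- \<omega>\<^sup>2 * w (a + x * z) + \<gamma> (a + x * z)) * (S / \<nu>))
      = \<nu> * S * w (a + x * z) - x\<^sup>2 * (S / \<nu> * (\<omega>\<^sup>2 * w (a + x * z))) + x\<^sup>2 * (S / \<nu> * \<gamma> (a + x * z))"
      by (simp add: power2_eq_square algebra_simps)
    then have eq: "\<nu> * S * w (a + x * z) + x * w' (a + x * z) * C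
        + x * (- C * w' (a + x * z) + x * (- \<omega>\<^sup>2 * w (a + x * z) + \<gamma> (a + x * z)) * (S / \<nu>))
      = x\<^sup>2 * (S / \<nu> * \<gamma> (a + x * z))"
      unfolding S by simp
    have "(W has_real_derivative x\<^sup>2 * (S / \<nu> * \<gamma> (a + x * z))) (at z within {0..1})"
      unfolding W_def
      using DERIV_add[OF DERIV_mult[OF cos path(1)] DERIV_cmult[OF DERIV_mult[OF sin path(2)], of x]]
      by (rule DERIV_cong) (use eq in \<open>simp add: S_def C_def\<close>)
    then show "(W has_vector_derivative x\<^sup>2 * (sin (\<nu> * (1 - z)) / \<nu> * \<gamma> (a + x * z))) (at z within {0..1})"
      by (simp only: has_real_derivative_iff_has_vector_derivative S_def)
  qed simp
  then show ?thesis by (simp add: W_def algebra_simps)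
qed

text \<open>Adding the formulas for x = h and x = -h eliminates \<open>w' a\<close>, which a
  two-step method does not know.\<close>

lemma two_step_variation_of_constants:
  fixes w w' \<gamma> :: "real \<Rightarrow> real"
  assumes w: "\<And>t. t \<in> {a - h..a + h} \<Longrightarrow> (w has_real_derivative w' t) (at t)"
    and w': "\<And>t. t \<in> {a - h..a + h} \<Longrightarrow> (w' has_real_derivative - \<omega>\<^sup>2 * w t + \<gamma> t) (at t)"
    and pos: "\<omega> > 0" "h > 0"
  shows "w (a + h) - 2 * cos (\<omega> * h) * w a + w (a - h)
    = h\<^sup>2 * oscillator_integral \<omega> (\<lambda>h x. \<gamma> (a + x)) h"
proof -
  have seg: "closed_segment a (a + h) \<subseteq> {a - h..a + h}" "closed_segment a (a + (- h)) \<subseteq> {a - h..a + h}"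
    using pos by (auto simp: closed_segment_eq_real_ivl)
  have "((\<lambda>z. h\<^sup>2 * (sin (\<omega> * h * (1 - z)) / (\<omega> * h) * \<gamma> (a + h * z))
        + (- h)\<^sup>2 * (sin (\<omega> * h * (1 - z)) / (\<omega> * h) * \<gamma> (a + - h * z))) has_integral
      (w (a + h) - cos (\<omega> * h) * w a - h * (sin (\<omega> * h) / (\<omega> * h)) * w' a)
      + (w (a + - h) - cos (\<omega> * h) * w a - - h * (sin (\<omega> * h) / (\<omega> * h)) * w' a)) {0..1}"
    using seg pos by (intro has_integral_add variation_of_constants[where \<omega> = \<omega>] w w') (auto simp: power_mult_distrib)
  moreover have "(\<lambda>z. h\<^sup>2 * (sin (\<omega> * h * (1 - z)) / (\<omega> * h) * \<gamma> (a + h * z))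
        + (- h)\<^sup>2 * (sin (\<omega> * h * (1 - z)) / (\<omega> * h) * \<gamma> (a + - h * z)))
      = (\<lambda>z. h\<^sup>2 * (sin (\<omega> * h * (1 - z)) / (\<omega> * h) * (\<gamma> (a + h * z) + \<gamma> (a + - h * z))))"
    by (simp add: fun_eq_iff distrib_left)
  ultimately have "h\<^sup>2 * oscillator_integral \<omega> (\<lambda>h x. \<gamma> (a + x)) h
      = (w (a + h) - cos (\<omega> * h) * w a - h * (sin (\<omega> * h) / (\<omega> * h)) * w' a)
      + (w (a + - h) - cos (\<omega> * h) * w a - - h * (sin (\<omega> * h) / (\<omega> * h)) * w' a)"
    unfolding oscillator_integral_def integral_mult_right[symmetric]
    by (intro integral_unique) simp
  then show ?thesis by simp
qed


section \<open>Sufficiency of the order conditions\<close>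

lemma Bfun_compose_cmult:
  fixes f :: "real \<Rightarrow> 'a :: real_normed_vector"
  assumes "Bfun f (at_right 0)" "\<omega> > 0"
  shows "Bfun (\<lambda>h. f (\<omega> * h)) (at_right 0)"
proof -
  obtain K where K: "\<forall>\<^sub>F \<nu> in at_right 0. norm (f \<nu>) \<le> K"
    using assms(1) by (rule BfunE)
  show ?thesis
    by (rule BfunI[OF eventually_compose_filterlim[OF K filterlim_cmult_at_right_0[OF assms(2)]]])
qed

lemma order_condition_compose_cmult:
  assumes "order_condition c A b q t" "\<omega> > 0"
  shows "(\<lambda>h. b (\<omega> * h) \<bullet> psi''_vec (c (\<omega> * h)) (A (\<omega> * h)) t
      - (1 + (-1) ^ rho t) * fact (rho t) * phi (rho t) (\<omega> * h)) \<in> O[at_right 0](\<lambda>h. h ^ (q + 1 - rho t))"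
proof -
  have "(\<lambda>h. b (\<omega> * h) \<bullet> psi''_vec (c (\<omega> * h)) (A (\<omega> * h)) t
      - (1 + (-1) ^ rho t) * fact (rho t) * phi (rho t) (\<omega> * h)) \<in> O[at_right 0](\<lambda>h. (\<omega> * h) ^ (q + 1 - rho t))"
    using landau_o.big.compose[OF assms(1)[unfolded order_condition_def] filterlim_cmult_at_right_0[OF assms(2)]] .
  then show ?thesis
    using assms(2) by (simp add: power_mult_distrib)
qed

text \<open>The coefficients are functions of h here; evaluation at \<nu> = \<omega> h is put in on
  interpretation. Since n is fixed, the grid point x_n tends to \<open>x0\<close> as h tends to
  0.\<close>

locale smooth_problem =
  fixes c b :: "real \<Rightarrow> real ^ 's" and A :: "real \<Rightarrow> real ^ 's ^ 's"
    and d k n :: nat and \<omega> \<alpha> \<beta> x0 :: real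
    and g :: "(nat \<Rightarrow> real) \<Rightarrow> nat \<Rightarrow> real"
    and y y' :: "real \<Rightarrow> nat \<Rightarrow> real" and Y :: "real \<Rightarrow> 's \<Rightarrow> nat \<Rightarrow> real"
  assumes bounded: "Bfun c (at_right 0)" "Bfun A (at_right 0)" "Bfun b (at_right 0)"
    and \<omega>: "\<omega> > 0"
    and smooth: "perturbation d k g"
    and y_Rd: "\<And>x. x \<in> {\<alpha><..<\<beta>} \<Longrightarrow> y x \<in> Rd d"
    and y_deriv: "\<And>x i. x \<in> {\<alpha><..<\<beta>} \<Longrightarrow> i < d \<Longrightarrow> ((\<lambda>x. y x i) has_real_derivative y' x i) (at x)"
    and y'_deriv: "\<And>x i. x \<in> {\<alpha><..<\<beta>} \<Longrightarrow> i < d \<Longrightarrow>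
      ((\<lambda>x. y' x i) has_real_derivative - \<omega>\<^sup>2 * y x i + g (y x) i) (at x)"
    and x0: "x0 \<in> {\<alpha><..<\<beta>}"
    and stages: "\<forall>\<^sub>F h in at_right 0. stage_equations (c h) (A h) d \<omega> g y (x0 + real n * h) h (Y h)"
    and Y_lim: "\<And>i j. i < d \<Longrightarrow> ((\<lambda>h. Y h j i) \<longlongrightarrow> y x0 i) (at_right 0)"
begin

abbreviation xn :: "real \<Rightarrow> real" where "xn h \<equiv> x0 + real n * h"

lemma eventually_near_x0:
  "\<exists>\<delta>>0. {x0 - \<delta>..x0 + \<delta>} \<subseteq> {\<alpha><..<\<beta>} \<and>
     (\<forall>\<^sub>F h in at_right 0. h > 0 \<and> (\<forall>x\<in>{-h..h}. xn h + x \<in> {x0 - \<delta>..x0 + \<delta>} \<and> \<bar>xn h + x - x0\<bar> \<le> real (Suc n) * h))"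
proof -
  \<comment> \<open>Half the distance to the boundary, so that the closed interval is a compact part
    of the interval of existence.\<close>
  define \<delta> where "\<delta> = min (x0 - \<alpha>) (\<beta> - x0) / 2"
  have "\<delta> > 0" "{x0 - \<delta>..x0 + \<delta>} \<subseteq> {\<alpha><..<\<beta>}"
    using x0 by (auto simp: \<delta>_def min_def field_simps)
  moreover have "\<forall>\<^sub>F h in at_right 0. h < \<delta> / real (Suc n)"
    using \<open>\<delta> > 0\<close>
    by (intro eventually_mono[OF eventually_at_right_real[of 0 "\<delta> / real (Suc n)"]]) auto
  with eventually_at_right_less[of "0::real"]
  have "\<forall>\<^sub>F h in at_right 0. h > 0 \<and> (\<forall>x\<in>{-h..h}. xn h + x \<in> {x0 - \<delta>..x0 + \<delta>} \<and> \<bar>xn h + x - x0\<bar> \<le> real (Suc n) * h)"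
  proof eventually_elim
    case (elim h)
    have \<delta>: "real (Suc n) * h \<le> \<delta>"
      using elim(2) by (simp add: field_simps del: of_nat_Suc)
    have "\<bar>xn h + x - x0\<bar> \<le> real (Suc n) * h" if "x \<in> {-h..h}" for x
    proof -
      have "0 \<le> real n * h" using elim(1) by simp
      moreover have "\<bar>x\<bar> \<le> h" using that by auto
      ultimately show ?thesis unfolding of_nat_Suc distrib_right by linarith
    qed
    moreover from this \<delta> have "xn h + x \<in> {x0 - \<delta>..x0 + \<delta>}" if "x \<in> {-h..h}" for x
      using that by (fastforce simp: abs_le_iff)
    ultimately show ?case using elim(1) by blast
  qed
  ultimately show ?thesis by blast
qed

lemma eventually_interval: "\<forall>\<^sub>F h in at_right 0. h > 0 \<and> (\<forall>x\<in>{-h..h}. xn h + x \<in> {\<alpha><..<\<beta>})"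
proof -
  obtain \<delta> where \<delta>: "{x0 - \<delta>..x0 + \<delta>} \<subseteq> {\<alpha><..<\<beta>}"
    "\<forall>\<^sub>F h in at_right 0. h > 0 \<and> (\<forall>x\<in>{-h..h}. xn h + x \<in> {x0 - \<delta>..x0 + \<delta>} \<and> \<bar>xn h + x - x0\<bar> \<le> real (Suc n) * h)"
    using eventually_near_x0 by blast
  from \<delta>(2) show ?thesis by (rule eventually_mono) (use \<delta>(1) in blast)
qed

lemma y_continuous: "i < d \<Longrightarrow> continuous_on {\<alpha><..<\<beta>} (\<lambda>x. y x i)"
  using y_deriv by (intro continuous_at_imp_continuous_on ballI) (blast intro: DERIV_isCont)

lemma y'_continuous: "i < d \<Longrightarrow> continuous_on {\<alpha><..<\<beta>} (\<lambda>x. y' x i)"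
  using y'_deriv by (intro continuous_at_imp_continuous_on ballI) (blast intro: DERIV_isCont)

text \<open>Mean value theorem with y' bounded on a compact interval. The reference point is
  \<open>x0\<close> and not x_n, because g must be approximated near a point independent of h; the
  price is the factor n + 1.\<close>

lemma y_near: "i < d \<Longrightarrow> uniform_bound 1 (\<lambda>h x. y (xn h + x) i - y x0 i)"
proof -
  assume i: "i < d"
  obtain \<delta> where \<delta>: "\<delta> > 0" "{x0 - \<delta>..x0 + \<delta>} \<subseteq> {\<alpha><..<\<beta>}"
    "\<forall>\<^sub>F h in at_right 0. h > 0 \<and> (\<forall>x\<in>{-h..h}. xn h + x \<in> {x0 - \<delta>..x0 + \<delta>} \<and> \<bar>xn h + x - x0\<bar> \<le> real (Suc n) * h)"
    using eventually_near_x0 by blast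
  have "compact ((\<lambda>x. y' x i) ` {x0 - \<delta>..x0 + \<delta>})"
    using continuous_on_subset[OF y'_continuous[OF i] \<delta>(2)] by (intro compact_continuous_image) auto
  from compact_imp_bounded[OF this] obtain B
    where "\<forall>v\<in>(\<lambda>x. y' x i) ` {x0 - \<delta>..x0 + \<delta>}. norm v \<le> B"
    unfolding bounded_iff by (elim exE)
  then have B: "norm (y' x i) \<le> B" if "x \<in> {x0 - \<delta>..x0 + \<delta>}" for x
    using that by simp
  have "B \<ge> 0" using B[of x0] \<delta>(1) by (intro order_trans[OF norm_ge_zero, of "y' x0 i"]) auto
  have "\<forall>\<^sub>F h in at_right 0. continuous_on {-h..h} (\<lambda>x. y (xn h + x) i - y x0 i) \<and>
      (\<forall>x\<in>{-h..h}. \<bar>y (xn h + x) i - y x0 i\<bar> \<le> B * real (Suc n) * h ^ 1)"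
    using \<delta>(3)
  proof eventually_elim
    case (elim h)
    have "continuous_on {-h..h} (\<lambda>x. y (xn h + x) i)"
      using elim \<delta>(2) by (intro continuous_on_compose2[OF y_continuous[OF i]] continuous_intros) blast+
    moreover have "\<bar>y (xn h + x) i - y x0 i\<bar> \<le> B * real (Suc n) * h ^ 1" if x: "x \<in> {-h..h}" for x
    proof -
      have "norm (y (xn h + x) i - y x0 i) \<le> B * norm (xn h + x - x0)"
      proof (rule field_differentiable_bound[where S = "{x0 - \<delta>..x0 + \<delta>}" and f = "\<lambda>x. y x i" and f' = "\<lambda>x. y' x i"])
        fix z assume "z \<in> {x0 - \<delta>..x0 + \<delta>}"
        with \<delta>(2) have "z \<in> {\<alpha><..<\<beta>}" by blast
        then show "((\<lambda>x. y x i) has_real_derivative y' z i) (at z within {x0 - \<delta>..x0 + \<delta>})"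
          by (rule has_field_derivative_at_within[OF y_deriv[OF _ i]])
      qed (use elim x \<delta>(1) B in auto)
      also have "\<dots> \<le> B * (real (Suc n) * h)"
        using elim x \<open>B \<ge> 0\<close> by (intro mult_left_mono) auto
      finally show ?thesis by simp
    qed
    ultimately show ?case by (auto intro: continuous_on_diff)
  qed
  then show ?thesis unfolding uniform_bound_def by blast
qed

lemma y_at_bigo:
  assumes "i < d" "\<forall>\<^sub>F h in at_right 0. \<xi> h \<in> {-h..h}"
  shows "(\<lambda>h. y (xn h + \<xi> h) i - y x0 i) \<in> O[at_right 0](\<lambda>h. h)"
  using uniform_bound_at[OF y_near[OF assms(1)] assms(2)] by simp

lemma y_xn_bigo: "i < d \<Longrightarrow> (\<lambda>h. y (xn h) i) \<in> O[at_right 0](\<lambda>_. 1)"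
  and y'_xn_bigo: "i < d \<Longrightarrow> (\<lambda>h. y' (xn h) i) \<in> O[at_right 0](\<lambda>_. 1)"
proof -
  have lim: "(xn \<longlongrightarrow> x0) (at_right 0)" by (auto intro!: tendsto_eq_intros)
  show "(\<lambda>h. y (xn h) i) \<in> O[at_right 0](\<lambda>_. 1)" if "i < d"
    by (rule bigoI_tendsto[where c = "y x0 i"])
      (use isCont_tendsto_compose[OF DERIV_isCont[OF y_deriv[OF x0 that]] lim] in simp_all)
  show "(\<lambda>h. y' (xn h) i) \<in> O[at_right 0](\<lambda>_. 1)" if "i < d"
    by (rule bigoI_tendsto[where c = "y' x0 i"])
      (use isCont_tendsto_compose[OF DERIV_isCont[OF y'_deriv[OF x0 that]] lim] in simp_all)
qed

lemma Y_Rd: "\<forall>\<^sub>F h in at_right 0. Y h j \<in> Rd d"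
  using stages by (rule eventually_mono) (simp add: stage_equations_def)

lemma stage_value:
  assumes "i < d"
  shows "\<forall>\<^sub>F h in at_right 0. Y h j i = y (xn h) i + c h $ j * (y (xn h) i - y (xn h - h) i)
    + h\<^sup>2 * (\<Sum>k\<in>UNIV. A h $ j $ k * (- \<omega>\<^sup>2 * Y h k i + g (Y h k) i))"
  using stages by (rule eventually_mono) (simp add: stage_equations_def assms algebra_simps)

lemma g_Y_bigo:
  assumes "i < d"
  shows "(\<lambda>h. g (Y h j) i) \<in> O[at_right 0](\<lambda>_. 1)"
proof -
  have "((\<lambda>h. Y h j l) \<longlongrightarrow> y x0 l) (at_right 0)" for l
  proof (cases "l < d")
    case False
    have "\<forall>\<^sub>F h in at_right 0. Y h j l = y x0 l"
      using Y_Rd[of j] by eventually_elim (use y_Rd[OF x0] False in \<open>auto simp: Rd_def\<close>)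
    then show ?thesis by (rule tendsto_eventually)
  qed (rule Y_lim)
  then have "((\<lambda>h. Y h j) \<longlongrightarrow> y x0) (at_right 0)"
    by (rule tendsto_coordinatewise)
  moreover have "continuous_on (Rd d) (\<lambda>u. g u i)"
    using smooth assms unfolding perturbation_def by (blast intro: Ck_continuous_on)
  ultimately have "((\<lambda>h. g (Y h j) i) \<longlongrightarrow> g (y x0) i) (at_right 0)"
    using y_Rd[OF x0] Y_Rd by (intro continuous_on_tendsto_compose[where f = "\<lambda>u. g u i" and s = "Rd d"]) auto
  then show ?thesis by (intro bigoI_tendsto[where c = "g (y x0) i"]) simp_all
qed

lemma Y_bigo: "i < d \<Longrightarrow> (\<lambda>h. Y h j i) \<in> O[at_right 0](\<lambda>_. 1)"
  using Y_lim by (intro bigoI_tendsto[where c = "y x0 i"]) simp_all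

text \<open>Convergence makes the stages and their images under g bounded; once this is put into the
  stage equations, every term on the right is within O(h) of its limit. Mere convergence thus
  becomes a rate.\<close>

lemma Y_near:
  assumes i: "i < d"
  shows "(\<lambda>h. Y h j i - y x0 i) \<in> O[at_right 0](\<lambda>h. h)"
proof -
  have "(\<lambda>h. y (xn h + 0) i - y x0 i) \<in> O[at_right 0](\<lambda>h. h)"
    by (intro y_at_bigo i eventually_mono[OF eventually_at_right_less[of "0::real"]]) simp
  then have 1: "(\<lambda>h. y (xn h) i - y x0 i) \<in> O[at_right 0](\<lambda>h. h)" by simp
  have "(\<lambda>h. y (xn h + - h) i - y x0 i) \<in> O[at_right 0](\<lambda>h. h)"
    by (intro y_at_bigo i eventually_mono[OF eventually_at_right_less[of "0::real"]]) simp
  from sum_in_bigo(2)[OF 1 this] have "(\<lambda>h. y (xn h) i - y (xn h - h) i) \<in> O[at_right 0](\<lambda>h. h)" by simp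
  from landau_o.big.mult[OF Bfun_vec_nth_bigo[OF bounded(1)] this]
  have 2: "(\<lambda>h. c h $ j * (y (xn h) i - y (xn h - h) i)) \<in> O[at_right 0](\<lambda>h. h)" by simp
  have "(\<lambda>h. \<Sum>k\<in>UNIV. A h $ j $ k * (- \<omega>\<^sup>2 * Y h k i + g (Y h k) i)) \<in> O[at_right 0](\<lambda>_. 1)"
    by (intro big_sum_in_bigo landau_o.big.mult_in_1 sum_in_bigo bigo_const Bfun_matrix_nth_bigo
        bounded Y_bigo g_Y_bigo i)
  then have "(\<lambda>h. h\<^sup>2 * (\<Sum>k\<in>UNIV. A h $ j $ k * (- \<omega>\<^sup>2 * Y h k i + g (Y h k) i))) \<in> O[at_right 0](\<lambda>h. h * 1)"
    using power_bigo_at_right_0[of 1 2] by (intro landau_o.big.mult) simp_all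
  then have 3: "(\<lambda>h. h\<^sup>2 * (\<Sum>k\<in>UNIV. A h $ j $ k * (- \<omega>\<^sup>2 * Y h k i + g (Y h k) i))) \<in> O[at_right 0](\<lambda>h. h)" by simp
  have "\<forall>\<^sub>F h in at_right 0. Y h j i - y x0 i = (y (xn h) i - y x0 i) + c h $ j * (y (xn h) i - y (xn h - h) i)
    + h\<^sup>2 * (\<Sum>k\<in>UNIV. A h $ j $ k * (- \<omega>\<^sup>2 * Y h k i + g (Y h k) i))"
    using stage_value[OF i, of j] by (rule eventually_mono) simp
  then show ?thesis
    using sum_in_bigo(1)[OF sum_in_bigo(1)[OF 1 2] 3] by (subst landau_o.big.in_cong)
qed

lemma forest_expansion_g:
  assumes "N \<le> k" "l < d"
    and exp: "\<And>i. i < d \<Longrightarrow> forest_expansion c A N (\<lambda>h x. y (xn h + x) i) (\<lambda>h j. Y h j i)"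
  shows "forest_expansion c A N (\<lambda>h x. g (y (xn h + x)) l) (\<lambda>h j. g (Y h j) l)"
proof (rule forest_expansion_compose[OF bounded(1,2), where F = "\<lambda>u. g u l"])
  show "Ck d N (\<lambda>u. g u l)"
    using smooth assms(1,2) unfolding perturbation_def by (blast intro: Ck_antimono)
  show "\<forall>\<^sub>F h in at_right 0. \<forall>x\<in>{-h..h}. y (xn h + x) \<in> Rd d"
    using eventually_interval by (rule eventually_mono) (use y_Rd in blast)
qed (use y_Rd[OF x0] Y_Rd exp y_near Y_near in auto)

text \<open>Taylor's formula and the stage equation match term by term: y(x_n) on the empty forest,
  y'(x_n) on the forest of \<open>TauPrime\<close>, and the rest through
  \<open>forest_expansion_taylor_remainder\<close>. The two are linked by y(x_n) - y(x_n - h) = h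
  y'(x_n) - J(-h).\<close>

lemma forest_expansion_step:
  assumes "N \<le> k"
    and exp: "\<And>i. i < d \<Longrightarrow> forest_expansion c A N (\<lambda>h x. y (xn h + x) i) (\<lambda>h j. Y h j i)"
    and i: "i < d"
  shows "forest_expansion c A (N + 2) (\<lambda>h x. y (xn h + x) i) (\<lambda>h j. Y h j i)"
proof -
  define f where "f h x = - \<omega>\<^sup>2 * y (xn h + x) i + g (y (xn h + x)) i" for h x
  define F where "F h j = - \<omega>\<^sup>2 * Y h j i + g (Y h j) i" for h j
  define J where "J = taylor_remainder f"
  have "forest_expansion c A N f F"
    unfolding f_def[abs_def] F_def[abs_def]
    by (intro forest_expansion.sum forest_expansion_mult[OF bounded(1,2)] forest_expansion_const bigo_const
        forest_expansion_g assms)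
  then have J: "forest_expansion c A (N + 2) J (\<lambda>h j. h\<^sup>2 * (\<Sum>k\<in>UNIV. A h $ j $ k * F h k) - c h $ j * J h (- h))"
    unfolding J_def by (rule forest_expansion_taylor_remainder[OF bounded(1,2)])
  have y: "forest_expansion c A (N + 2) (\<lambda>h x. y (xn h) i) (\<lambda>h j. y (xn h) i)"
    by (intro forest_expansion_const y_xn_bigo i)
  have "forest_expansion c A (N + 2) (\<lambda>h x. y' (xn h) i * x ^ (\<Sum>t\<in>#{#TauPrime#}. rho t))
    (\<lambda>h j. y' (xn h) i * (h ^ (\<Sum>t\<in>#{#TauPrime#}. rho t) * (\<Prod>t\<in>#{#TauPrime#}. psi (c h) (A h) t j)))"
    using i by (intro forest_expansion.forest y'_xn_bigo) (auto intro: T2.intros)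
  then have y': "forest_expansion c A (N + 2) (\<lambda>h x. y' (xn h) i * x) (\<lambda>h j. y' (xn h) i * (h * c h $ j))"
    by simp
  have taylor: "\<forall>\<^sub>F h in at_right 0. \<forall>x\<in>{-h..h}. y (xn h + x) i = y (xn h) i + y' (xn h) i * x + J h x"
    using eventually_interval
  proof eventually_elim
    case (elim h)
    show ?case
    proof
      fix x assume x: "x \<in> {-h..h}"
      have seg: "t \<in> {\<alpha><..<\<beta>}" if "t \<in> closed_segment (xn h) (xn h + x)" for t
      proof -
        have "t - xn h \<in> {-h..h}"
          using that x elim by (auto simp: closed_segment_eq_real_ivl split: if_splits)
        with elim show ?thesis by fastforce
      qed
      show "y (xn h + x) i = y (xn h) i + y' (xn h) i * x + J h x"
        using taylor_second_order[where w = "\<lambda>x. y x i" and a = "xn h" and x = x,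
            OF y_deriv[OF seg i] y'_deriv[OF seg i]]
        by (simp add: J_def taylor_remainder_def f_def add.assoc mult.commute[of "y' (xn h) i"])
    qed
  qed
  show ?thesis
  proof (rule forest_expansion_cong[OF forest_expansion.sum[OF forest_expansion.sum[OF y y'] J] taylor])
    fix j
    show "\<forall>\<^sub>F h in at_right 0. Y h j i = y (xn h) i + y' (xn h) i * (h * c h $ j)
        + (h\<^sup>2 * (\<Sum>k\<in>UNIV. A h $ j $ k * F h k) - c h $ j * J h (- h))"
      using taylor stage_value[OF i, of j] eventually_at_right_less[of "0::real"]
    proof eventually_elim
      case (elim h)
      then have "y (xn h + - h) i = y (xn h) i + y' (xn h) i * - h + J h (- h)"
        by (intro bspec[OF elim(1)]) simp
      then have "y (xn h) i - y (xn h - h) i = y' (xn h) i * h - J h (- h)"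
        by simp
      with elim(2) show ?case
        by (simp only: F_def) (simp add: algebra_simps)
    qed
  qed
qed

text \<open>At order 0 a remainder need only be bounded, which starts the induction. The step to 2m
  + 2 composes with g at order 2m, which accounts for the bound on m.\<close>

lemma forest_expansion_solution:
  "2 * m \<le> k + 2 \<Longrightarrow> i < d \<Longrightarrow> forest_expansion c A (2 * m) (\<lambda>h x. y (xn h + x) i) (\<lambda>h j. Y h j i)"
proof (induction m arbitrary: i)
  case 0
  have "forest_expansion c A 0 (\<lambda>h x. y (xn h + x) i - y x0 i) (\<lambda>h j. Y h j i - y x0 i)"
  proof (rule forest_expansion.remainder)
    show "uniform_bound 0 (\<lambda>h x. y (xn h + x) i - y x0 i)"
      using uniform_bound_antimono[OF y_near] 0 by simp
    show "(\<lambda>h. Y h j i - y x0 i) \<in> O[at_right 0](\<lambda>h. h ^ 0)" for j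
      using sum_in_bigo(2)[OF Y_bigo bigo_const] 0 by simp
  qed
  from forest_expansion.sum[OF this forest_expansion_const[OF bigo_const[of "y x0 i"]]]
  show ?case by simp
next
  case (Suc m)
  then show ?case using forest_expansion_step[of "2 * m" i] by simp
qed

lemma local_error_bigo:
  assumes q: "1 \<le> q" "2 * q \<le> k"
    and order: "\<And>t. t \<in> T2 \<Longrightarrow> t \<noteq> EmptyTree \<Longrightarrow> rho t \<le> q \<Longrightarrow>
      (\<lambda>h. b h \<bullet> psi''_vec (c h) (A h) t - (1 + (-1) ^ rho t) * fact (rho t) * phi (rho t) (\<omega> * h))
        \<in> O[at_right 0](\<lambda>h. h ^ (q + 1 - rho t))"
    and i: "i < d"
  shows "(\<lambda>h. norm (local_error (b h) \<omega> g y (xn h) h (Y h) i)) \<in> O[at_right 0](\<lambda>h. h ^ q)"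
proof -
  define u where "u h x = g (y (xn h + x)) i" for h x
  define D where "D h = oscillator_integral \<omega> u h - (\<Sum>j\<in>UNIV. b h $ j * g (Y h j) i)" for h
  have "forest_expansion c A (2 * q) u (\<lambda>h j. g (Y h j) i)"
    unfolding u_def[abs_def] using q i by (intro forest_expansion_g forest_expansion_solution) auto
  then have "D \<in> O[at_right 0](\<lambda>h. h ^ (q - 1))"
    unfolding D_def by (intro forest_expansion_defect[OF bounded \<omega> _ order]) auto
  then have "(\<lambda>h. h * D h) \<in> O[at_right 0](\<lambda>h. h * h ^ (q - 1))"
    by (rule landau_o.big.mult_left)
  moreover have "h * h ^ (q - 1) = h ^ q" for h :: real
    using q by (simp flip: power_Suc)
  ultimately have "(\<lambda>h. \<bar>h * D h\<bar>) \<in> O[at_right 0](\<lambda>h. h ^ q)"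
    by (simp only: landau_o.big.abs_in_iff)
  moreover have "\<forall>\<^sub>F h in at_right 0. norm (local_error (b h) \<omega> g y (xn h) h (Y h) i) = \<bar>h * D h\<bar>"
    using eventually_interval
  proof eventually_elim
    case (elim h)
    then have "h > 0" by blast
    have sub: "t \<in> {\<alpha><..<\<beta>}" if "t \<in> {xn h - h..xn h + h}" for t
    proof -
      have "t - xn h \<in> {-h..h}" using that by auto
      with elim show ?thesis by fastforce
    qed
    \<comment> \<open>The h inside \<open>xn h\<close> is fixed while the functional binds an
      argument of its own; since the functional evaluates only at this same h, the two readings
      coincide.\<close>
    have "y (xn h + h) i - 2 * cos (\<omega> * h) * y (xn h) i + y (xn h - h) i
        = h\<^sup>2 * oscillator_integral \<omega> (\<lambda>h' x. g (y (xn h + x)) i) h"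
      by (rule two_step_variation_of_constants[where w' = "\<lambda>t. y' t i" and w = "\<lambda>t. y t i"
            and \<gamma> = "\<lambda>t. g (y t) i", OF y_deriv[OF sub i] y'_deriv[OF sub i] \<omega> \<open>h > 0\<close>])
    also have "oscillator_integral \<omega> (\<lambda>h' x. g (y (xn h + x)) i) h = oscillator_integral \<omega> u h"
      by (simp add: oscillator_integral_def u_def)
    finally show ?case
      using \<open>h > 0\<close> unfolding norm_local_error[OF \<omega> \<open>h > 0\<close>]
      by (simp add: D_def power2_eq_square right_diff_distrib)
  qed
  ultimately show ?thesis
    by (subst landau_o.big.in_cong)
qed

end

section \<open>Equivalence of the order of the local error and the order conditions\<close>

lemma local_error_order_of_order_conditions:
  fixes c b :: "real \<Rightarrow> real ^ 's" and A :: "real \<Rightarrow> real ^ 's ^ 's"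
  assumes bounded: "Bfun c (at_right 0)" "Bfun A (at_right 0)" "Bfun b (at_right 0)"
    and q: "1 \<le> q"
    and order: "\<And>t. t \<in> T2 \<Longrightarrow> t \<noteq> EmptyTree \<Longrightarrow> rho t \<le> q \<Longrightarrow> order_condition c A b q t"
  shows "local_error_order c A b q"
  unfolding local_error_order_def
\<comment> \<open>Each round of the bootstrap gains two orders, so q rounds reach order 2q, and the
  last composition with g at that order uses \<open>Ck\<close> with k = 2q.\<close>
proof (intro exI[of _ "2 * q"] allI impI, elim conjE)
  fix d \<omega> g y \<alpha> \<beta> x0 n i and Y :: "real \<Rightarrow> 's \<Rightarrow> nat \<Rightarrow> real"
  assume \<omega>: "\<omega> > 0" and pert: "perturbation d (2 * q) g" and sol: "solves_oscillator d \<omega> g y {\<alpha><..<\<beta>}"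
    and x0: "x0 \<in> {\<alpha><..<\<beta>}"
    and stages: "\<forall>\<^sub>F h in at_right 0. stage_equations (c (\<omega> * h)) (A (\<omega> * h)) d \<omega> g y (x0 + real n * h) h (Y h)"
    and lim: "\<forall>j. \<forall>i<d. ((\<lambda>h. Y h j i) \<longlongrightarrow> y x0 i) (at_right 0)" and i: "i < d"
  obtain y' where y: "\<forall>x\<in>{\<alpha><..<\<beta>}. y x \<in> Rd d" and
    y': "\<forall>x\<in>{\<alpha><..<\<beta>}. \<forall>i<d. ((\<lambda>x. y x i) has_real_derivative y' x i) (at x) \<and>
      ((\<lambda>x. y' x i) has_real_derivative (- \<omega>\<^sup>2 * y x i + g (y x) i)) (at x)"
    using sol unfolding solves_oscillator_def by blast
  interpret smooth_problem "\<lambda>h. c (\<omega> * h)" "\<lambda>h. b (\<omega> * h)" "\<lambda>h. A (\<omega> * h)" d "2 * q" n \<omega> \<alpha> \<beta> x0 g y y' Y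
    using \<omega> pert x0 stages lim y y' by unfold_locales (auto intro: Bfun_compose_cmult bounded)
  show "(\<lambda>h. norm (local_error (b (\<omega> * h)) \<omega> g y (x0 + real n * h) h (Y h) i)) \<in> O[at_right 0](\<lambda>h. h ^ q)"
    using q i order_condition_compose_cmult[OF order \<omega>] by (intro local_error_bigo) auto
qed

lemma local_error_order_iff_order_conditions:
  fixes c b :: "real \<Rightarrow> real ^ 's" and A :: "real \<Rightarrow> real ^ 's ^ 's"
  assumes "Bfun c (at_right 0)" "Bfun A (at_right 0)" "Bfun b (at_right 0)" "1 \<le> q"
  shows "local_error_order c A b q \<longleftrightarrow>
    (\<forall>t \<in> T2 - {EmptyTree}. rho t \<le> q \<longrightarrow> order_condition c A b q t)"
  using order_condition_of_local_error_order[OF assms(1-3)] local_error_order_of_order_conditions[OF assms]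
  by auto

lemma local_error_order_antimono:
  assumes "local_error_order c A b q" "r \<le> q"
  shows "local_error_order c A b r"
  using assms(1) unfolding local_error_order_def
proof (elim exE, intro exI allI impI)
  fix k d \<omega> g y \<alpha> \<beta> and x0 :: real and n :: nat and Y i
  assume order: "\<forall>d \<omega> g y \<alpha> \<beta> (x0::real) (n::nat) Y.
     \<omega> > 0 \<and> perturbation d k g \<and> solves_oscillator d \<omega> g y {\<alpha><..<\<beta>} \<and> x0 \<in> {\<alpha><..<\<beta>} \<and>
     (\<forall>\<^sub>F h in at_right 0. stage_equations (c (\<omega> * h)) (A (\<omega> * h)) d \<omega> g y (x0 + real n * h) h (Y h)) \<and>
     (\<forall>j. \<forall>i<d. ((\<lambda>h. Y h j i) \<longlongrightarrow> y x0 i) (at_right 0)) \<longrightarrow>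
     (\<forall>i<d. (\<lambda>h. norm (local_error (b (\<omega> * h)) \<omega> g y (x0 + real n * h) h (Y h) i)) \<in> O[at_right 0](\<lambda>h. h ^ q))"
    and problem: "\<omega> > 0 \<and> perturbation d k g \<and> solves_oscillator d \<omega> g y {\<alpha><..<\<beta>} \<and> x0 \<in> {\<alpha><..<\<beta>} \<and>
     (\<forall>\<^sub>F h in at_right 0. stage_equations (c (\<omega> * h)) (A (\<omega> * h)) d \<omega> g y (x0 + real n * h) h (Y h)) \<and>
     (\<forall>j. \<forall>i<d. ((\<lambda>h. Y h j i) \<longlongrightarrow> y x0 i) (at_right 0))" and i: "i < d"
  show "(\<lambda>h. norm (local_error (b (\<omega> * h)) \<omega> g y (x0 + real n * h) h (Y h) i)) \<in> O[at_right 0](\<lambda>h. h ^ r)"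
    using landau_o.big_trans[OF order[rule_format, OF problem i] power_bigo_at_right_0[OF assms(2)]] .
qed

text \<open>Boundedness of the coefficients near 0 lets remainders keep their order when multiplied
  by entries of \<open>c\<close>, \<open>A\<close> and \<open>b\<close>. With p + 2 in place of p +
  1, \<open>order_condition\<close> demands one more power of \<nu> from the trees of lower order
  too, so the negated part ranges over all trees of order at most p + 2.\<close>

theorem theorem2:
  fixes c b :: "real \<Rightarrow> real ^ 's" and A :: "real \<Rightarrow> real ^ 's ^ 's" and p :: nat
  assumes "Bfun c (at_right 0)" and "Bfun A (at_right 0)" and "Bfun b (at_right 0)"
  shows "algebraic_order c A b p \<longleftrightarrow>
    (\<forall>t \<in> T2 - {EmptyTree}. rho t \<le> p + 1 \<longrightarrow> order_condition c A b (p + 1) t) \<and>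
    \<not> (\<forall>t \<in> T2 - {EmptyTree}. rho t \<le> p + 2 \<longrightarrow> order_condition c A b (p + 2) t)"
proof -
  \<comment> \<open>Any order above p would imply O(h^(p+2)) by
    \<open>local_error_order_antimono\<close>, so maximality amounts to one failure.\<close>
  have "(\<forall>q. local_error_order c A b (q + 1) \<longrightarrow> q \<le> p) \<longleftrightarrow> \<not> local_error_order c A b (p + 2)"
  proof
    assume "\<forall>q. local_error_order c A b (q + 1) \<longrightarrow> q \<le> p"
    from this[rule_format, of "p + 1"] show "\<not> local_error_order c A b (p + 2)" by auto
  next
    assume not: "\<not> local_error_order c A b (p + 2)"
    show "\<forall>q. local_error_order c A b (q + 1) \<longrightarrow> q \<le> p"
      using not local_error_order_antimono[of c A b _ "p + 2"] by (metis Suc_eq_plus1 add_2_eq_Suc' not_less_eq_eq)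
  qed
  then show ?thesis
    unfolding algebraic_order_def
    using local_error_order_iff_order_conditions[OF assms, of "p + 1"]
      local_error_order_iff_order_conditions[OF assms, of "p + 2"] by simp
qed

end
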